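(* Let $C$ be a class of models (representations of boolean functions $f:\{0,1\}^n\to\{0,1\}$, each model having a size). Suppose that: (1) $C$ has a proper and exact learning algorithm $A$ running in $2^{O(n)}$ time, where $n$ is the number of variables of the target function; and (2) $C$ has an algorithm $B$ that receives a model $c\in C$ and outputs a minimum-size model $c'\in C$ computing the same function as $c$, running in $2^{O(n)}$ time. Then $C$ has a polynomial truth-table minimization algorithm, i.e. an algorithm that, given the full truth table of $f$ (a string of length $N=2^n$), runs in time polynomial in $N$ and outputs a minimum-size model in $C$ computing $f$ (or rejects if no model in $C$ computes $f$).
   Context: A learning algorithm for $C$ has oracle access to a target function $f$ (promised to be computed by some model in $C$) through one or more of the following queries: membership queries (the algorithm gives $x\in\{0,1\}^n$ and receives $f(x)$); equivalence queries (the algorithm gives a hypothesis $h\in C$ and receives either "yes" if $h$ computes $f$, or some $x$ with $h(x)\neq f(x)$); relevant possibility queries (the algorithm gives a set of literals and is told whether it is a subset of some minterm of $f$). It outputs a hypothesis. It is exact if the hypothesis agrees with $f$ on all assignments, and proper if the hypothesis is a member of $C$. Standing convention: every model in $C$ on $n$ variables can be evaluated on a given input in $2^{O(n)}$ time.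
   Formalization: "Proper" is required even when the target f is computed by no model in C: whenever A halts, its hypothesis is a model in C on n variables. With properness only for targets in C the claim fails, e.g. for an undecidable set of functions, each represented by its own truth table. *)

theory Defs
  imports Complex_Main "HOL-Library.Landau_Symbols"
begin

section \<open>Machine model\<close>

text \<open>
  Algorithms are structured programs over finitely many registers, each holding a stack of bits;
  every elementary step costs one time unit and touches only the top of one stack. A Turing machine
  tape is a pair of stacks, so this is the multi-tape (oracle) Turing machine up to a constant
  factor in time. An oracle query replaces the contents of a register by the answer, at unit cost.
\<close>

type_synonym bits = "bool list"
type_synonym state = "nat \<Rightarrow> bits"

datatype (queries: 'q) prog =
    Skip
  | Push nat bool
  | Pop nat
  | Query 'q nat
  | Seq "'q prog" "'q prog"
  | Case nat "'q prog" "'q prog" "'q prog"  \<comment> \<open>stack empty, top bit 0, top bit 1\<close>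
  | While nat "'q prog"  \<comment> \<open>while the stack is nonempty\<close>

type_synonym 'q oracle_fun = "'q \<Rightarrow> bits \<Rightarrow> bits"

inductive exec :: "'q oracle_fun \<Rightarrow> 'q prog \<Rightarrow> state \<Rightarrow> nat \<Rightarrow> state \<Rightarrow> bool" for ora where
  Skip: "exec ora Skip s 1 s"
| Push: "exec ora (Push r b) s 1 (s(r := b # s r))"
| Pop: "exec ora (Pop r) s 1 (s(r := tl (s r)))"
| Query: "exec ora (Query q r) s 1 (s(r := ora q (s r)))"
| Seq: "exec ora p s t s' \<Longrightarrow> exec ora p' s' t' s'' \<Longrightarrow> exec ora (Seq p p') s (t + t') s''"
| Case_Nil: "s r = [] \<Longrightarrow> exec ora p s t s' \<Longrightarrow> exec ora (Case r p p0 p1) s (t + 1) s'"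
| Case_0: "s r = False # w \<Longrightarrow> exec ora p0 s t s' \<Longrightarrow> exec ora (Case r p p0 p1) s (t + 1) s'"
| Case_1: "s r = True # w \<Longrightarrow> exec ora p1 s t s' \<Longrightarrow> exec ora (Case r p p0 p1) s (t + 1) s'"
| While_end: "s r = [] \<Longrightarrow> exec ora (While r p) s 1 s"
| While_step: "s r \<noteq> [] \<Longrightarrow> exec ora p s t s' \<Longrightarrow> exec ora (While r p) s' t' s''
    \<Longrightarrow> exec ora (While r p) s (t + t' + 1) s''"

lemma exec_deterministic:
  "exec ora p s t s' \<Longrightarrow> exec ora p s u s'' \<Longrightarrow> u = t \<and> s'' = s'"
proof (induction arbitrary: u s'' rule: exec.induct)
  case (Skip s)
  then show ?case by (cases rule: exec.cases) auto
next
  case (Push r b s)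
  then show ?case by (cases rule: exec.cases) auto
next
  case (Pop r s)
  then show ?case by (cases rule: exec.cases) auto
next
  case (Query q r s)
  then show ?case by (cases rule: exec.cases) auto
next
  case (Seq p s t s' p' t' s3)
  from Seq.prems show ?case
    by (cases rule: exec.cases) (use Seq.IH in blast)
next
  case (Case_Nil s r p t s' p0 p1)
  from Case_Nil.prems Case_Nil.hyps show ?case
    by (cases rule: exec.cases) (auto dest: Case_Nil.IH)
next
  case (Case_0 s r w p0 t s' p p1)
  from Case_0.prems Case_0.hyps show ?case
    by (cases rule: exec.cases) (auto dest: Case_0.IH)
next
  case (Case_1 s r w p1 t s' p p0)
  from Case_1.prems Case_1.hyps show ?case
    by (cases rule: exec.cases) (auto dest: Case_1.IH)
next
  case (While_end s r p)
  from While_end.prems While_end.hyps show ?case by (cases rule: exec.cases) auto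
next
  case (While_step s r p t s' t' s3)
  from While_step.prems While_step.hyps(1) show ?case
  proof (cases rule: exec.cases)
    case (While_step t1 s1 t2)
    with While_step.IH show ?thesis by blast
  qed simp
qed

text \<open>Inputs are placed in the first registers, all others are empty; the output is register 0.\<close>

definition initial :: "bits list \<Rightarrow> state" where
  "initial ws r = (if r < length ws then ws ! r else [])"

definition halts_with :: "'q oracle_fun \<Rightarrow> 'q prog \<Rightarrow> bits list \<Rightarrow> nat \<Rightarrow> bits \<Rightarrow> bool" where
  "halts_with ora p ws t out \<longleftrightarrow> (\<exists>s. exec ora p (initial ws) t s \<and> s 0 = out)"

text \<open>Programs without oracle access; the oracle argument is then immaterial.\<close>

definition computes_within :: "unit prog \<Rightarrow> bits list \<Rightarrow> nat \<Rightarrow> bits \<Rightarrow> bool" where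
  "computes_within p ws b out \<longleftrightarrow>
     queries p = {} \<and> (\<exists>t\<le>b. halts_with (\<lambda>_ _. []) p ws t out)"

definition two_pow_O_n :: "(nat \<Rightarrow> nat) \<Rightarrow> bool" where
  "two_pow_O_n T \<longleftrightarrow> (\<exists>g \<in> O(\<lambda>n. real n). \<forall>n. real (T n) \<le> 2 powr g n)"

definition polynomially_bounded :: "(nat \<Rightarrow> nat) \<Rightarrow> bool" where
  "polynomially_bounded T \<longleftrightarrow> (\<exists>k. (\<lambda>N. real (T N)) \<in> O(\<lambda>N. real N ^ k))"

section \<open>Classes of models\<close>

text \<open>
  A model is a bit string. Only the values of \<open>nvars\<close>, \<open>func\<close> and \<open>model_size\<close> on members of
  \<open>models\<close> matter, and only the values of \<open>func c\<close> on inputs of length \<open>nvars c\<close>.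
\<close>

record model_class =
  models :: "bits set"
  nvars :: "bits \<Rightarrow> nat"
  func :: "bits \<Rightarrow> bits \<Rightarrow> bool"
  model_size :: "bits \<Rightarrow> nat"

definition computes :: "model_class \<Rightarrow> bits \<Rightarrow> nat \<Rightarrow> (bits \<Rightarrow> bool) \<Rightarrow> bool" where
  "computes C c n f \<longleftrightarrow> nvars C c = n \<and> (\<forall>x. length x = n \<longrightarrow> func C c x = f x)"

definition computable_in :: "model_class \<Rightarrow> nat \<Rightarrow> (bits \<Rightarrow> bool) \<Rightarrow> bool" where
  "computable_in C n f \<longleftrightarrow> (\<exists>c \<in> models C. computes C c n f)"

definition minimum_model :: "model_class \<Rightarrow> nat \<Rightarrow> (bits \<Rightarrow> bool) \<Rightarrow> bits \<Rightarrow> bool" where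
  "minimum_model C n f c \<longleftrightarrow> c \<in> models C \<and> computes C c n f \<and>
     (\<forall>c' \<in> models C. computes C c' n f \<longrightarrow> model_size C c \<le> model_size C c')"

definition evaluator :: "model_class \<Rightarrow> unit prog \<Rightarrow> (nat \<Rightarrow> nat) \<Rightarrow> bool" where
  "evaluator C E T \<longleftrightarrow> (\<forall>c \<in> models C. \<forall>x. length x = nvars C c \<longrightarrow>
     computes_within E [c, x] (T (nvars C c)) [func C c x])"

definition model_minimizer :: "model_class \<Rightarrow> unit prog \<Rightarrow> (nat \<Rightarrow> nat) \<Rightarrow> bool" where
  "model_minimizer C B T \<longleftrightarrow> (\<forall>c \<in> models C. \<exists>c'.
     computes_within B [c] (T (nvars C c)) c' \<and> minimum_model C (nvars C c) (func C c) c')"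

section \<open>Minterms\<close>

text \<open>
  The literal \<open>(i, True)\<close> is the variable with index \<open>i\<close>, and \<open>(i, False)\<close> is its negation.
  A minterm is an inclusion-minimal implicant (also called prime implicant).
\<close>

type_synonym literal = "nat \<times> bool"

definition implicant :: "nat \<Rightarrow> (bits \<Rightarrow> bool) \<Rightarrow> literal set \<Rightarrow> bool" where
  "implicant n f M \<longleftrightarrow> M \<subseteq> {..<n} \<times> UNIV \<and> (\<nexists>i. (i, True) \<in> M \<and> (i, False) \<in> M) \<and>
     (\<forall>x. length x = n \<and> (\<forall>(i, b) \<in> M. x ! i = b) \<longrightarrow> f x)"

definition minterm :: "nat \<Rightarrow> (bits \<Rightarrow> bool) \<Rightarrow> literal set \<Rightarrow> bool" where
  "minterm n f M \<longleftrightarrow> implicant n f M \<and> (\<forall>M'. M' \<subset> M \<longrightarrow> \<not> implicant n f M')"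

text \<open>
  An arbitrary set of literals over \<open>n\<close> variables is written as a string of length \<open>2 * n\<close>:
  positions \<open>2 * i\<close> and \<open>2 * i + 1\<close> tell whether \<open>(i, True)\<close> and \<open>(i, False)\<close> belong to it.
\<close>

definition literals_of :: "nat \<Rightarrow> bits \<Rightarrow> literal set" where
  "literals_of n w = {(i, b). i < n \<and> w ! (2 * i + (if b then 0 else 1))}"

section \<open>Learning with queries\<close>

datatype query = Membership | Equivalence | Relevant_Possibility

text \<open>
  The equivalence answer is \<open>[True]\<close> for ``yes'' and \<open>False # x\<close> for a counterexample \<open>x\<close>.
  Answers to ill-formed queries (wrong length, or a string that is not a model in the class on
  \<open>n\<close> variables) are unconstrained: a learner must cope with any of them.
  Counterexamples are adversarial, but a function of the hypothesis; assuming success only against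
  such oracles is no loss, since a learner can store earlier answers.
\<close>

definition oracle_for :: "model_class \<Rightarrow> nat \<Rightarrow> (bits \<Rightarrow> bool) \<Rightarrow> query oracle_fun \<Rightarrow> bool" where
  "oracle_for C n f ora \<longleftrightarrow>
     (\<forall>x. length x = n \<longrightarrow> ora Membership x = [f x]) \<and>
     (\<forall>h \<in> models C. nvars C h = n \<longrightarrow>
        (if computes C h n f then ora Equivalence h = [True]
         else \<exists>x. length x = n \<and> func C h x \<noteq> f x \<and> ora Equivalence h = False # x)) \<and>
     (\<forall>w. length w = 2 * n \<longrightarrow>
        ora Relevant_Possibility w = [\<exists>M. minterm n f M \<and> literals_of n w \<subseteq> M])"

text \<open>A learner receives \<open>n\<close> in unary.\<close>

definition exact_learner :: "model_class \<Rightarrow> query prog \<Rightarrow> (nat \<Rightarrow> nat) \<Rightarrow> bool" where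
  "exact_learner C A T \<longleftrightarrow> (\<forall>n f ora. computable_in C n f \<and> oracle_for C n f ora \<longrightarrow>
     (\<exists>t h. t \<le> T n \<and> halts_with ora A [replicate n True] t h \<and> computes C h n f))"

text \<open>
  Hypotheses belong to the class whatever function the queries are answered for. If this were
  required only for targets in the class, an undecidable set of functions, each represented by its
  own truth table, would have a learner (read the table), a minimizer (the identity) and an
  evaluator (table lookup), but no truth-table minimizer, as that has to reject the other functions.
\<close>

definition proper_learner :: "model_class \<Rightarrow> query prog \<Rightarrow> bool" where
  "proper_learner C A \<longleftrightarrow> (\<forall>n f ora t h. oracle_for C n f ora \<and>
     halts_with ora A [replicate n True] t h \<longrightarrow> h \<in> models C \<and> nvars C h = n)"

section \<open>Truth-table minimization\<close>

fun inputs :: "nat \<Rightarrow> bits list" where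
  "inputs 0 = [[]]"
| "inputs (Suc n) = map (Cons False) (inputs n) @ map (Cons True) (inputs n)"

definition truth_table :: "nat \<Rightarrow> (bits \<Rightarrow> bool) \<Rightarrow> bits" where
  "truth_table n f = map f (inputs n)"

text \<open>The output is \<open>True # c\<close> for a model \<open>c\<close>, and \<open>[False]\<close> for rejection.\<close>

definition truth_table_minimizer :: "model_class \<Rightarrow> unit prog \<Rightarrow> (nat \<Rightarrow> nat) \<Rightarrow> bool" where
  "truth_table_minimizer C D T \<longleftrightarrow> (\<forall>n f. \<exists>out.
     computes_within D [truth_table n f] (T (2 ^ n)) out \<and>
     (if computable_in C n f then \<exists>c. out = True # c \<and> minimum_model C n f c
      else out = [False]))"

end

theory Submission
  imports Defs
begin

text \<open>
  Since \<open>N = 2 ^ n\<close>, time \<open>2 ^ O(n)\<close> is time polynomial in \<open>N\<close>, and so is a search through all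
  inputs or through all \<open>4 ^ n\<close> sets of literals. Hence the truth table answers every query of the
  learner \<open>A\<close> in polynomial time: membership by lookup, relevant possibility by exhaustive search
  over literal sets, equivalence by evaluating the hypothesis on all inputs. An ill-formed hypothesis
  might make the evaluator diverge, and a target outside the class might make \<open>A\<close> diverge, so both
  run against a clock of polynomial length. If \<open>A\<close> halts in time with a hypothesis that agrees with
  the table, \<open>B\<close> minimizes it; otherwise, as \<open>A\<close> is exact and proper, no model computes the table.
\<close>

section \<open>Basic programs\<close>

text \<open>Tracking registers and running times through the whole construction would be
  unmanageable, so programs are hidden behind a calculus: a \<open>polyfun\<close> can be compiled
  for any placement of its arguments, and the class is closed under case distinction, binding,
  iteration and clocked simulation. The minimizer is then an ordinary function on strings. Two
  obstacles shape the calculus. Iterating a polynomial-time step can blow up the data, so iteration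
  and simulation carry explicit bounds on lengths. And \<open>A\<close>, \<open>B\<close> and
  \<open>E\<close> are arbitrary programs with registers of their own and no promise of halting on
  arbitrary strings. They are not called but translated: registers are shifted, every step is
  charged to a clock, and each query becomes a program that computes the answer. Numbers (the arity,
  loop counters, clocks) are unary, that is, lengths of strings; this is affordable because the
  input already has length \<open>2 ^ n\<close>. The exponent of the clock is a constant fixed when
  the program is built.\<close>

definition runs :: "unit prog \<Rightarrow> state \<Rightarrow> nat \<Rightarrow> state \<Rightarrow> bool" where
  "runs p s b s' \<longleftrightarrow> (\<exists>t\<le>b. exec (\<lambda>_ _. []) p s t s')"

lemma runs_mono: "runs p s b s' \<Longrightarrow> b \<le> b' \<Longrightarrow> runs p s b' s'"
  unfolding runs_def by (meson le_trans)

lemma runs_eq: "runs p s b s' \<Longrightarrow> b \<le> b' \<Longrightarrow> s' = s'' \<Longrightarrow> runs p s b' s''"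
  using runs_mono by blast

lemma runs_Skip: "runs Skip s 1 s"
  unfolding runs_def using exec.Skip by blast

lemma runs_Push: "runs (Push r b) s 1 (s(r := b # s r))"
  unfolding runs_def using exec.Push by blast

lemma runs_Pop: "runs (Pop r) s 1 (s(r := tl (s r)))"
  unfolding runs_def using exec.Pop by blast

lemma runs_Seq: "runs p s b s' \<Longrightarrow> runs p' s' b' s'' \<Longrightarrow> runs (Seq p p') s (b + b') s''"
  unfolding runs_def using exec.Seq add_mono by metis

lemma runs_Case_Nil: "s r = [] \<Longrightarrow> runs p s b s' \<Longrightarrow> runs (Case r p p0 p1) s (b + 1) s'"
  unfolding runs_def using exec.Case_Nil by (metis add_le_mono1)

lemma runs_Case_Cons:
  "s r = v # w \<Longrightarrow> runs (if v then p1 else p0) s b s' \<Longrightarrow> runs (Case r p p0 p1) s (b + 1) s'"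
  unfolding runs_def
  by (cases v; clarsimp; rule_tac x = "t + 1" in exI) (simp_all add: exec.Case_0 exec.Case_1 del: add_Suc_right One_nat_def)

lemma runs_While_end: "s r = [] \<Longrightarrow> runs (While r p) s 1 s"
  unfolding runs_def using exec.While_end by blast

lemma runs_While_step:
  "s r \<noteq> [] \<Longrightarrow> runs p s b s' \<Longrightarrow> runs (While r p) s' b' s'' \<Longrightarrow> runs (While r p) s (b + b' + 1) s''"
  unfolding runs_def using exec.While_step by (metis add_le_mono1 add_mono)

section \<open>Emptying, moving and copying stacks\<close>

definition clear :: "nat \<Rightarrow> unit prog" where
  "clear r = While r (Pop r)"

lemma queries_clear [simp]: "queries (clear r) = {}"
  by (simp add: clear_def)

lemma runs_clear: "runs (clear r) s (2 * length (s r) + 1) (s(r := []))"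
proof (induction "s r" arbitrary: s)
  case Nil
  then show ?case
    using runs_While_end[of s r] by (simp add: clear_def fun_upd_idem)
next
  case (Cons v w)
  let ?s = "s(r := tl (s r))"
  from Cons.hyps have len: "length (s r) = Suc (length (?s r))"
    by (metis fun_upd_same length_Cons list.sel(3))
  have "runs (clear r) ?s (2 * length (?s r) + 1) (?s(r := []))"
    by (rule Cons.hyps(1)) (use Cons.hyps(2) in \<open>metis fun_upd_same list.sel(3)\<close>)
  from runs_While_step[OF _ runs_Pop this[unfolded clear_def]] Cons.hyps(2)
  have "runs (clear r) s (1 + (2 * length (?s r) + 1) + 1) (?s(r := []))"
    unfolding clear_def by (metis list.discI)
  then show ?case
    by (rule runs_eq) (use len in auto)
qed

definition pour :: "nat \<Rightarrow> nat \<Rightarrow> unit prog" where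
  "pour a b = While a (Case a Skip (Seq (Pop a) (Push b False)) (Seq (Pop a) (Push b True)))"

lemma queries_pour [simp]: "queries (pour a b) = {}"
  by (simp add: pour_def)

lemma runs_pour:
  assumes "a \<noteq> b"
  shows "runs (pour a b) s (4 * length (s a) + 1) (s(a := [], b := rev (s a) @ s b))"
  using refl[of "s a"]
proof (induction "s a" arbitrary: s)
  case Nil
  then show ?case
    using runs_While_end[of s a] by (simp add: pour_def fun_upd_idem)
next
  case (Cons v w)
  let ?s = "s(a := w, b := v # s b)"
  have len: "length (s a) = Suc (length w)"
    using Cons.hyps(2) by (metis length_Cons)
  have ih: "runs (pour a b) ?s (4 * length (?s a) + 1) (?s(a := [], b := rev (?s a) @ ?s b))"
    by (rule Cons.hyps(1)) (use assms in auto)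
  have "runs (Seq (Pop a) (Push b v)) s (1 + 1) ?s"
    by (rule runs_eq[OF runs_Seq[OF runs_Pop runs_Push]])
      (use assms Cons.hyps(2)[symmetric] in auto)
  then have "runs (Case a Skip (Seq (Pop a) (Push b False)) (Seq (Pop a) (Push b True))) s (1 + 1 + 1) ?s"
    by (intro runs_Case_Cons[where s = s and r = a, OF Cons.hyps(2)[symmetric]]) (cases v; simp)
  from runs_While_step[OF _ this ih[unfolded pour_def]] Cons.hyps(2)
  have "runs (pour a b) s (1 + 1 + 1 + (4 * length (?s a) + 1) + 1) (?s(a := [], b := rev (?s a) @ ?s b))"
    unfolding pour_def by (metis list.discI)
  then show ?case
    by (rule runs_eq) (use assms len Cons.hyps(2)[symmetric] in auto)
qed

definition pour2 :: "nat \<Rightarrow> nat \<Rightarrow> nat \<Rightarrow> unit prog" where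
  "pour2 a b c = While a (Case a Skip
     (Seq (Pop a) (Seq (Push b False) (Push c False)))
     (Seq (Pop a) (Seq (Push b True) (Push c True))))"

lemma queries_pour2 [simp]: "queries (pour2 a b c) = {}"
  by (simp add: pour2_def)

lemma runs_pour2:
  assumes "distinct [a, b, c]"
  shows "runs (pour2 a b c) s (5 * length (s a) + 1)
    (s(a := [], b := rev (s a) @ s b, c := rev (s a) @ s c))"
  using refl[of "s a"]
proof (induction "s a" arbitrary: s)
  case Nil
  then show ?case
    using runs_While_end[of s a] by (simp add: pour2_def fun_upd_idem)
next
  case (Cons v w)
  let ?s = "s(a := w, b := v # s b, c := v # s c)"
  let ?p = "\<lambda>v. Seq (Pop a) (Seq (Push b v) (Push c v))"
  have len: "length (s a) = Suc (length w)"
    using Cons.hyps(2) by (metis length_Cons)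
  have ih: "runs (pour2 a b c) ?s (5 * length (?s a) + 1)
      (?s(a := [], b := rev (?s a) @ ?s b, c := rev (?s a) @ ?s c))"
    by (rule Cons.hyps(1)) (use assms in auto)
  have "runs (?p v) s (1 + (1 + 1)) ?s"
    by (rule runs_eq[OF runs_Seq[OF runs_Pop runs_Seq[OF runs_Push runs_Push]]])
      (use assms Cons.hyps(2)[symmetric] in auto)
  then have "runs (Case a Skip (?p False) (?p True)) s (1 + (1 + 1) + 1) ?s"
    by (intro runs_Case_Cons[where s = s and r = a, OF Cons.hyps(2)[symmetric]]) (cases v; simp)
  from runs_While_step[OF _ this ih[unfolded pour2_def]] Cons.hyps(2)
  have "runs (pour2 a b c) s (1 + (1 + 1) + 1 + (5 * length (?s a) + 1) + 1)
      (?s(a := [], b := rev (?s a) @ ?s b, c := rev (?s a) @ ?s c))"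
    unfolding pour2_def by (metis list.discI)
  then show ?case
    by (rule runs_eq) (use assms len Cons.hyps(2)[symmetric] in auto)
qed

text \<open>Pouring a stack reverses it, so the detour through \<open>c\<close> restores the order;
  the second pass refills \<open>a\<close> along with \<open>b\<close>.\<close>

definition copy :: "nat \<Rightarrow> nat \<Rightarrow> nat \<Rightarrow> unit prog" where
  "copy a b c = Seq (pour a c) (pour2 c a b)"

lemma queries_copy [simp]: "queries (copy a b c) = {}"
  by (simp add: copy_def)

lemma runs_copy:
  assumes "distinct [a, b, c]" "s b = []" "s c = []"
  shows "runs (copy a b c) s (9 * length (s a) + 2) (s(b := s a))"
  unfolding copy_def
  by (rule runs_eq[OF runs_Seq[OF runs_pour runs_pour2]]) (use assms in auto)

definition move :: "nat \<Rightarrow> nat \<Rightarrow> nat \<Rightarrow> unit prog" where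
  "move a b c = Seq (pour a c) (pour c b)"

lemma queries_move [simp]: "queries (move a b c) = {}"
  by (simp add: move_def)

lemma runs_move:
  assumes "distinct [a, b, c]" "s b = []" "s c = []"
  shows "runs (move a b c) s (8 * length (s a) + 2) (s(a := [], b := s a))"
  unfolding move_def
  by (rule runs_eq[OF runs_Seq[OF runs_pour runs_pour]]) (use assms in auto)

section \<open>Functions computable in polynomial time\<close>

text \<open>The base \<open>n + 2\<close> is at least 2 even for \<open>n = 0\<close>, so every
  constant lies below some power and no separate factor or threshold has to be carried
  along.\<close>

definition poly_bounded :: "(nat \<Rightarrow> nat) \<Rightarrow> bool" where
  "poly_bounded g \<longleftrightarrow> (\<exists>k. \<forall>n. g n \<le> (n + 2) ^ k)"

lemma poly_bounded_const: "poly_bounded (\<lambda>_. c)"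
proof -
  have "c \<le> (n + 2) ^ c" for n
    using less_exp[of c] power_mono[of 2 "n + 2" c] by linarith
  then show ?thesis
    unfolding poly_bounded_def by blast
qed

lemma poly_bounded_id: "poly_bounded (\<lambda>n. n)"
  unfolding poly_bounded_def by (intro exI[of _ 1]) simp

lemma poly_bounded_mult:
  assumes "poly_bounded f" "poly_bounded g"
  shows "poly_bounded (\<lambda>n. f n * g n)"
proof -
  obtain k l where "\<And>n. f n \<le> (n + 2) ^ k" "\<And>n. g n \<le> (n + 2) ^ l"
    using assms unfolding poly_bounded_def by blast
  then have "f n * g n \<le> (n + 2) ^ (k + l)" for n
    unfolding power_add by (rule mult_le_mono)
  then show ?thesis
    unfolding poly_bounded_def by blast
qed

lemma poly_bounded_add:
  assumes "poly_bounded f" "poly_bounded g"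
  shows "poly_bounded (\<lambda>n. f n + g n)"
proof -
  obtain k l where fg: "\<And>n. f n \<le> (n + 2) ^ k" "\<And>n. g n \<le> (n + 2) ^ l"
    using assms unfolding poly_bounded_def by blast
  \<comment> \<open>The additional factor \<open>n + 2\<close> pays for the sum of two
    terms.\<close>
  have "f n + g n \<le> (n + 2) ^ (k + l + 1)" for n :: nat
  proof -
    have "f n \<le> (n + 2) ^ (k + l)" "g n \<le> (n + 2) ^ (k + l)"
      using fg[of n] power_increasing[of k "k + l" "n + 2"] power_increasing[of l "k + l" "n + 2"]
      by linarith+
    then have "f n + g n \<le> 2 * (n + 2) ^ (k + l)"
      by linarith
    also have "\<dots> \<le> (n + 2) * (n + 2) ^ (k + l)"
      by (rule mult_le_mono1) simp
    finally show ?thesis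
      by simp
  qed
  then show ?thesis
    unfolding poly_bounded_def by blast
qed

lemma poly_bounded_power:
  assumes "poly_bounded f"
  shows "poly_bounded (\<lambda>n. f n ^ k)"
proof (induction k)
  case 0
  then show ?case using poly_bounded_const by simp
next
  case (Suc k)
  then show ?case using poly_bounded_mult[OF assms] by simp
qed

lemmas poly_bounded_intros =
  poly_bounded_const poly_bounded_id poly_bounded_mult poly_bounded_add poly_bounded_power

definition total_length :: "bits list \<Rightarrow> nat" where
  "total_length ws = (\<Sum>w\<leftarrow>ws. length w)"

lemma total_length_Cons [simp]: "total_length (w # ws) = length w + total_length ws"
  by (simp add: total_length_def)

lemma total_length_Nil [simp]: "total_length [] = 0"
  by (simp add: total_length_def)

lemma length_le_total_length: "w \<in> set ws \<Longrightarrow> length w \<le> total_length ws"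
  by (induction ws) auto

lemma length_nth_le_total_length: "i < length ws \<Longrightarrow> length (ws ! i) \<le> total_length ws"
  by (simp add: length_le_total_length)

definition assigns :: "unit prog \<Rightarrow> nat list \<Rightarrow> nat \<Rightarrow> nat \<Rightarrow> (bits list \<Rightarrow> bits) \<Rightarrow> (nat \<Rightarrow> nat) \<Rightarrow> bool" where
  "assigns p ins out base F T \<longleftrightarrow> queries p = {} \<and>
     (\<forall>s. s out = [] \<and> (\<forall>r\<ge>base. s r = []) \<longrightarrow>
       runs p s (T (total_length (map s ins))) (s(out := F (map s ins))))"

text \<open>
  A program for \<open>F\<close> behaves like an assignment: it preserves its inputs and leaves the scratch
  registers, those from \<open>base\<close> on, empty. This makes programs for different functions composable.
  Only the values of \<open>F\<close> on lists of length \<open>m\<close> matter.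
\<close>

definition polyfun :: "nat \<Rightarrow> (bits list \<Rightarrow> bits) \<Rightarrow> bool" where
  "polyfun m F \<longleftrightarrow>
     (\<exists>T. poly_bounded T \<and> (\<forall>ws. length ws = m \<longrightarrow> length (F ws) \<le> T (total_length ws))) \<and>
     (\<forall>ins out base. length ins = m \<and> set ins \<subseteq> {..<base} \<and> out < base \<and> out \<notin> set ins \<longrightarrow>
       (\<exists>p T. poly_bounded T \<and> assigns p ins out base F T))"

lemma poly_boundedE:
  assumes "poly_bounded g"
  obtains k where "\<And>n. g n \<le> (n + 2) ^ k"
  using assms unfolding poly_bounded_def by blast

lemma polyfunI:
  assumes "poly_bounded T" "\<And>ws. length ws = m \<Longrightarrow> length (F ws) \<le> T (total_length ws)"
    and "\<And>ins out base. length ins = m \<Longrightarrow> set ins \<subseteq> {..<base} \<Longrightarrow> out < base \<Longrightarrow> out \<notin> set ins \<Longrightarrow>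
       \<exists>p T. poly_bounded T \<and> assigns p ins out base F T"
  shows "polyfun m F"
  using assms unfolding polyfun_def by blast

lemma polyfun_length:
  assumes "polyfun m F"
  obtains k where "\<And>ws. length ws = m \<Longrightarrow> length (F ws) \<le> (total_length ws + 2) ^ k"
  using assms unfolding polyfun_def poly_bounded_def by (meson le_trans)

lemma polyfun_prog:
  assumes "polyfun m F" "length ins = m" "set ins \<subseteq> {..<base}" "out < base" "out \<notin> set ins"
  obtains p k where "queries p = {}"
    "\<And>s. s out = [] \<Longrightarrow> (\<And>r. r \<ge> base \<Longrightarrow> s r = []) \<Longrightarrow>
       runs p s ((total_length (map s ins) + 2) ^ k) (s(out := F (map s ins)))"
proof -
  obtain p T where p: "poly_bounded T" "assigns p ins out base F T"
    using assms unfolding polyfun_def by blast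
  from p(1) obtain k where k: "\<And>n. T n \<le> (n + 2) ^ k"
    by (rule poly_boundedE) blast
  show ?thesis
  proof (rule that[of p k])
    show "queries p = {}"
      using p(2) unfolding assigns_def by blast
    show "runs p s ((total_length (map s ins) + 2) ^ k) (s(out := F (map s ins)))"
      if "s out = []" "\<And>r. r \<ge> base \<Longrightarrow> s r = []" for s
      using p(2) that runs_mono[OF _ k] unfolding assigns_def by blast
  qed
qed

lemma polyfun_cong:
  assumes "polyfun m F" "\<And>ws. length ws = m \<Longrightarrow> F ws = G ws"
  shows "polyfun m G"
proof -
  have *: "assigns p ins out base F T \<longleftrightarrow> assigns p ins out base G T" if "length ins = m" for p ins out base T
    using that assms(2) by (simp add: assigns_def)
  show ?thesis
    using assms * unfolding polyfun_def by (metis (no_types, lifting))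
qed


section \<open>Projections, constants and tests\<close>

lemma polyfun_nth:
  assumes "i < m"
  shows "polyfun m (\<lambda>ws. ws ! i)"
proof (rule polyfunI)
  show "poly_bounded (\<lambda>n. n)"
    by (rule poly_bounded_id)
  show "length (ws ! i) \<le> total_length ws" if "length ws = m" for ws :: "bits list"
    using that assms by (simp add: length_nth_le_total_length)
next
  fix ins :: "nat list" and out base :: nat
  assume ins: "length ins = m" "set ins \<subseteq> {..<base}" "out < base" "out \<notin> set ins"
  let ?a = "ins ! i"
  have a: "?a \<in> set ins"
    using ins(1) assms by simp
  have "assigns (copy ?a out base) ins out base (\<lambda>ws. ws ! i) (\<lambda>n. 9 * n + 2)"
    unfolding assigns_def
  proof (intro conjI allI impI)
    fix s :: state
    assume s: "s out = [] \<and> (\<forall>r\<ge>base. s r = [])"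
    have "length (s ?a) \<le> total_length (map s ins)"
      using a by (simp add: length_le_total_length)
    moreover have "distinct [?a, out, base]"
      using a ins by (auto dest: subsetD)
    ultimately show "runs (copy ?a out base) s (9 * total_length (map s ins) + 2) (s(out := map s ins ! i))"
      using s ins(1) assms by (intro runs_eq[OF runs_copy]) auto
  qed simp
  moreover have "poly_bounded (\<lambda>n. 9 * n + 2)"
    by (intro poly_bounded_intros)
  ultimately show "\<exists>p T. poly_bounded T \<and> assigns p ins out base (\<lambda>ws. ws ! i) T"
    by blast
qed

lemma polyfun_Nil: "polyfun m (\<lambda>_. [])"
proof (rule polyfunI)
  show "poly_bounded (\<lambda>_. 1)"
    by (rule poly_bounded_const)
next
  fix ins :: "nat list" and out base :: nat
  have "assigns Skip ins out base (\<lambda>_. []) (\<lambda>_. 1)"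
    unfolding assigns_def by (auto intro!: runs_eq[OF runs_Skip])
  then show "\<exists>p T. poly_bounded T \<and> assigns p ins out base (\<lambda>_. []) T"
    using poly_bounded_const by blast
qed simp

text \<open>A linear-time program that rewrites the output register in place needs no scratch
  register, so it can be appended to the program for \<open>F\<close>.\<close>

lemma polyfun_postprocess:
  assumes F: "polyfun m F"
    and q: "\<And>out. queries (q out) = {}"
      "\<And>s out. runs (q out) s (c * length (s out) + c) (s(out := g (s out)))"
    and g: "\<And>w. length (g w) \<le> length w + c"
  shows "polyfun m (\<lambda>ws. g (F ws))"
proof -
  from F obtain l where l: "\<And>ws. length ws = m \<Longrightarrow> length (F ws) \<le> (total_length ws + 2) ^ l"
    by (rule polyfun_length) blast
  show ?thesis
  proof (rule polyfunI)
    show "poly_bounded (\<lambda>n. (n + 2) ^ l + c)"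
      by (intro poly_bounded_intros)
    show "length (g (F ws)) \<le> (total_length ws + 2) ^ l + c" if "length ws = m" for ws
      using g[of "F ws"] l[OF that] by linarith
  next
    fix ins :: "nat list" and out base :: nat
    assume ins: "length ins = m" "set ins \<subseteq> {..<base}" "out < base" "out \<notin> set ins"
    with F obtain p k where p: "queries p = {}"
      "\<And>s. s out = [] \<Longrightarrow> (\<And>r. r \<ge> base \<Longrightarrow> s r = []) \<Longrightarrow>
         runs p s ((total_length (map s ins) + 2) ^ k) (s(out := F (map s ins)))"
      by (rule polyfun_prog) blast
    let ?T = "\<lambda>n. (n + 2) ^ k + (c * (n + 2) ^ l + c)"
    have "assigns (Seq p (q out)) ins out base (\<lambda>ws. g (F ws)) ?T"
      unfolding assigns_def
    proof (intro conjI allI impI)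
      fix s :: state
      assume s: "s out = [] \<and> (\<forall>r\<ge>base. s r = [])"
      show "runs (Seq p (q out)) s (?T (total_length (map s ins))) (s(out := g (F (map s ins))))"
        by (rule runs_eq[OF runs_Seq[OF p(2) q(2)]]) (use s ins(1) l in auto)
    qed (use p q in auto)
    moreover have "poly_bounded ?T"
      by (intro poly_bounded_intros)
    ultimately show "\<exists>p T. poly_bounded T \<and> assigns p ins out base (\<lambda>ws. g (F ws)) T"
      by blast
  qed
qed

lemma polyfun_Cons: "polyfun m F \<Longrightarrow> polyfun m (\<lambda>ws. b # F ws)"
  by (rule polyfun_postprocess[where q = "\<lambda>out. Push out b" and c = 1])
    (auto intro: runs_eq[OF runs_Push])

lemma polyfun_tl: "polyfun m F \<Longrightarrow> polyfun m (\<lambda>ws. tl (F ws))"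
  by (rule polyfun_postprocess[where q = "\<lambda>out. Pop out" and c = 1])
    (auto intro: runs_eq[OF runs_Pop])

text \<open>Truth is coded by nonemptiness of a stack, so one \<open>Case\<close> decides it and one
  \<open>Pop\<close> removes it again.\<close>

definition polypred :: "nat \<Rightarrow> (bits list \<Rightarrow> bool) \<Rightarrow> bool" where
  "polypred m P \<longleftrightarrow> polyfun m (\<lambda>ws. if P ws then [True] else [])"

definition top_bit :: "bits \<Rightarrow> bool" where
  "top_bit w \<longleftrightarrow> w \<noteq> [] \<and> hd w"

lemma top_bit_simps [simp]: "\<not> top_bit []" "top_bit (b # w) \<longleftrightarrow> b"
  by (simp_all add: top_bit_def)

lemma polypred_top_bit:
  assumes "polyfun m F"
  shows "polypred m (\<lambda>ws. top_bit (F ws))"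
  unfolding polypred_def
proof (rule polyfun_postprocess[OF assms, where c = 3 and
    q = "\<lambda>out. Case out Skip (clear out) (Seq (clear out) (Push out True))"])
  fix s :: state and out
  show "runs (Case out Skip (clear out) (Seq (clear out) (Push out True))) s
      (3 * length (s out) + 3) (s(out := if top_bit (s out) then [True] else []))"
  proof (cases "s out")
    case Nil
    then show ?thesis
      by (intro runs_eq[OF runs_Case_Nil[OF _ runs_Skip]]) (auto simp: fun_upd_idem)
  next
    case (Cons v w)
    then show ?thesis
      by (cases v) (auto intro!: runs_eq[OF runs_Case_Cons[where s = s and r = out, OF Cons]] runs_clear
          runs_Seq[OF runs_clear runs_Push])
  qed
qed auto

lemma polypred_nonempty:
  assumes "polyfun m F"
  shows "polypred m (\<lambda>ws. F ws \<noteq> [])"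
  unfolding polypred_def
proof (rule polyfun_postprocess[OF assms, where c = 3 and
    q = "\<lambda>out. Case out Skip (Seq (clear out) (Push out True)) (Seq (clear out) (Push out True))"])
  fix s :: state and out
  show "runs (Case out Skip (Seq (clear out) (Push out True)) (Seq (clear out) (Push out True))) s
      (3 * length (s out) + 3) (s(out := if s out \<noteq> [] then [True] else []))"
  proof (cases "s out")
    case Nil
    then show ?thesis
      by (intro runs_eq[OF runs_Case_Nil[OF _ runs_Skip]]) (auto simp: fun_upd_idem)
  next
    case (Cons v w)
    then show ?thesis
      by (cases v) (auto intro!: runs_eq[OF runs_Case_Cons[where s = s and r = out, OF Cons]] 
          runs_Seq[OF runs_clear runs_Push])
  qed
qed auto

section \<open>Branching, binding and iteration\<close>

lemma polyfun_if:
  assumes P: "polypred m P" and F: "polyfun m F" and G: "polyfun m G"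
  shows "polyfun m (\<lambda>ws. if P ws then F ws else G ws)"
proof -
  from F obtain lf where lf: "\<And>ws. length ws = m \<Longrightarrow> length (F ws) \<le> (total_length ws + 2) ^ lf"
    by (rule polyfun_length) blast
  from G obtain lg where lg: "\<And>ws. length ws = m \<Longrightarrow> length (G ws) \<le> (total_length ws + 2) ^ lg"
    by (rule polyfun_length) blast
  show ?thesis
  proof (rule polyfunI)
    show "poly_bounded (\<lambda>n. (n + 2) ^ lf + (n + 2) ^ lg)"
      by (intro poly_bounded_intros)
    show "length (if P ws then F ws else G ws) \<le> (total_length ws + 2) ^ lf + (total_length ws + 2) ^ lg"
      if "length ws = m" for ws
      using lf[OF that] lg[OF that] by simp
  next
    fix ins :: "nat list" and out base :: nat
    assume ins: "length ins = m" "set ins \<subseteq> {..<base}" "out < base" "out \<notin> set ins"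
    have base: "base \<notin> set ins" "set ins \<subseteq> {..<base + 1}" "out < base + 1" "base < base + 1"
      using ins by auto
    \<comment> \<open>Register \<open>base\<close> receives the value of the test, so all three
      programs are compiled with scratch space from \<open>base + 1\<close> on. The test value is
      gone before a branch starts.\<close>
    from P[unfolded polypred_def] ins(1) base(2,4,1) obtain pc kc where pc: "queries pc = {}"
      "\<And>s. s base = [] \<Longrightarrow> (\<And>r. r \<ge> base + 1 \<Longrightarrow> s r = []) \<Longrightarrow>
         runs pc s ((total_length (map s ins) + 2) ^ kc) (s(base := if P (map s ins) then [True] else []))"
      by (rule polyfun_prog) blast
    from F ins(1) base(2,3) ins(4) obtain pf kf where pf: "queries pf = {}"
      "\<And>s. s out = [] \<Longrightarrow> (\<And>r. r \<ge> base + 1 \<Longrightarrow> s r = []) \<Longrightarrow>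
         runs pf s ((total_length (map s ins) + 2) ^ kf) (s(out := F (map s ins)))"
      by (rule polyfun_prog) blast
    from G ins(1) base(2,3) ins(4) obtain pg kg where pg: "queries pg = {}"
      "\<And>s. s out = [] \<Longrightarrow> (\<And>r. r \<ge> base + 1 \<Longrightarrow> s r = []) \<Longrightarrow>
         runs pg s ((total_length (map s ins) + 2) ^ kg) (s(out := G (map s ins)))"
      by (rule polyfun_prog) blast
    let ?p = "Seq pc (Case base pg Skip (Seq (Pop base) pf))"
    let ?T = "\<lambda>n. (n + 2) ^ kc + ((n + 2) ^ kf + (n + 2) ^ kg + 2)"
    have "assigns ?p ins out base (\<lambda>ws. if P ws then F ws else G ws) ?T"
      unfolding assigns_def
    proof (intro conjI allI impI)
      fix s :: state
      assume s: "s out = [] \<and> (\<forall>r\<ge>base. s r = [])"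
      let ?s = "s(base := if P (map s ins) then [True] else [])"
      let ?n = "total_length (map s ins)"
      have 1: "runs pc s ((?n + 2) ^ kc) ?s"
        by (rule pc(2)) (use s in auto)
      have id: "s(base := []) = s"
        using s by (auto simp: fun_upd_idem)
      have 2: "runs (Case base pg Skip (Seq (Pop base) pf)) ?s ((?n + 2) ^ kf + (?n + 2) ^ kg + 2)
          (s(out := if P (map s ins) then F (map s ins) else G (map s ins)))"
      proof (cases "P (map s ins)")
        case True
        have 3: "runs pf s ((?n + 2) ^ kf) (s(out := F (map s ins)))"
          by (rule pf(2)) (use s in auto)
        have "runs (Pop base) ?s 1 s"
          by (rule runs_eq[OF runs_Pop]) (use True id in auto)
        from runs_Seq[OF this 3] have "runs (Case base pg Skip (Seq (Pop base) pf)) ?s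
            (1 + (?n + 2) ^ kf + 1) (s(out := F (map s ins)))"
          using True by (intro runs_Case_Cons[where v = True and w = "[]"]) auto
        then show ?thesis
          by (rule runs_eq) (use True in auto)
      next
        case False
        have "runs pg s ((?n + 2) ^ kg) (s(out := G (map s ins)))"
          by (rule pg(2)) (use s in auto)
        then have "runs (Case base pg Skip (Seq (Pop base) pf)) s ((?n + 2) ^ kg + 1) (s(out := G (map s ins)))"
          using s by (intro runs_Case_Nil) auto
        then show ?thesis
          using False id runs_mono[of _ _ "(?n + 2) ^ kg + 1"] by simp
      qed
      show "runs ?p s (?T ?n) (s(out := if P (map s ins) then F (map s ins) else G (map s ins)))"
        by (rule runs_Seq[OF 1 2])
    qed (use pc pf pg in auto)
    moreover have "poly_bounded ?T"
      by (intro poly_bounded_intros)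
    ultimately show "\<exists>p T. poly_bounded T \<and> assigns p ins out base (\<lambda>ws. if P ws then F ws else G ws) T"
      by blast
  qed
qed

text \<open>Composition in the form of a binding, in the style of de Bruijn indices: inside
  \<open>G\<close> the new value is \<open>hd\<close>, and the older arguments are
  \<open>tl\<close>. The value lives in register \<open>base\<close>, which is cleared at the
  end.\<close>

lemma polyfun_let:
  assumes F: "polyfun m F" and G: "polyfun (Suc m) G"
  shows "polyfun m (\<lambda>ws. G (F ws # ws))"
proof -
  from F obtain lf where lf: "\<And>ws. length ws = m \<Longrightarrow> length (F ws) \<le> (total_length ws + 2) ^ lf"
    by (rule polyfun_length) blast
  from G obtain lg where lg: "\<And>ws. length ws = Suc m \<Longrightarrow> length (G ws) \<le> (total_length ws + 2) ^ lg"
    by (rule polyfun_length) blast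
  have le: "((length (F ws) + total_length ws) + 2) ^ k \<le> (((total_length ws + 2) ^ lf + total_length ws) + 2) ^ k"
    if "length ws = m" for ws k
    by (rule power_mono) (use lf[OF that] in auto)
  show ?thesis
  proof (rule polyfunI)
    show "poly_bounded (\<lambda>n. ((n + 2) ^ lf + n + 2) ^ lg)"
      by (intro poly_bounded_intros)
    show "length (G (F ws # ws)) \<le> ((total_length ws + 2) ^ lf + total_length ws + 2) ^ lg"
      if "length ws = m" for ws
      using le_trans[OF lg[of "F ws # ws"]] le[OF that] that by simp
  next
    fix ins :: "nat list" and out base :: nat
    assume ins: "length ins = m" "set ins \<subseteq> {..<base}" "out < base" "out \<notin> set ins"
    have base: "base \<notin> set ins" "set ins \<subseteq> {..<base + 1}" "out < base + 1" "base < base + 1"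
      "length (base # ins) = Suc m" "set (base # ins) \<subseteq> {..<base + 1}" "out \<notin> set (base # ins)"
      using ins by auto
    from F ins(1) base(2,4,1) obtain pf kf where pf: "queries pf = {}"
      "\<And>s. s base = [] \<Longrightarrow> (\<And>r. r \<ge> base + 1 \<Longrightarrow> s r = []) \<Longrightarrow>
         runs pf s ((total_length (map s ins) + 2) ^ kf) (s(base := F (map s ins)))"
      by (rule polyfun_prog) blast
    from G base(5,6,3,7) obtain pg kg where pg: "queries pg = {}"
      "\<And>s. s out = [] \<Longrightarrow> (\<And>r. r \<ge> base + 1 \<Longrightarrow> s r = []) \<Longrightarrow>
         runs pg s ((total_length (map s (base # ins)) + 2) ^ kg) (s(out := G (map s (base # ins))))"
      by (rule polyfun_prog) blast
    let ?p = "Seq pf (Seq pg (clear base))"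
    let ?T = "\<lambda>n. (n + 2) ^ kf + (((n + 2) ^ lf + n + 2) ^ kg + (2 * (n + 2) ^ lf + 1))"
    have "assigns ?p ins out base (\<lambda>ws. G (F ws # ws)) ?T"
      unfolding assigns_def
    proof (intro conjI allI impI)
      fix s :: state
      assume s: "s out = [] \<and> (\<forall>r\<ge>base. s r = [])"
      let ?ws = "map s ins"
      let ?s = "s(base := F ?ws)"
      have 1: "runs pf s ((total_length ?ws + 2) ^ kf) ?s"
        by (rule pf(2)) (use s in auto)
      have "runs pg ?s ((total_length (map ?s (base # ins)) + 2) ^ kg) (?s(out := G (map ?s (base # ins))))"
        by (rule pg(2)) (use s ins in auto)
      then have 2: "runs pg ?s (((total_length ?ws + 2) ^ lf + total_length ?ws + 2) ^ kg) (?s(out := G (F ?ws # ?ws)))"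
        by (rule runs_eq) (use le[of ?ws kg] ins(1) base(1) in auto)
      have 3: "runs (clear base) (?s(out := G (F ?ws # ?ws))) (2 * (total_length ?ws + 2) ^ lf + 1) (s(out := G (F ?ws # ?ws)))"
        by (rule runs_eq[OF runs_clear]) (use s ins lf in \<open>auto simp: fun_eq_iff\<close>)
      show "runs ?p s (?T (total_length ?ws)) (s(out := G (F ?ws # ?ws)))"
        by (rule runs_Seq[OF 1 runs_Seq[OF 2 3]])
    qed (use pf pg in auto)
    moreover have "poly_bounded ?T"
      by (intro poly_bounded_intros)
    ultimately show "\<exists>p T. poly_bounded T \<and> assigns p ins out base (\<lambda>ws. G (F ws # ws)) T"
      by blast
  qed
qed

text \<open>Weakening: this allows a function of the outer arguments to be used under a
  binder.\<close>

lemma polyfun_weaken: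
  assumes F: "polyfun m F"
  shows "polyfun (Suc m) (\<lambda>vs. F (tl vs))"
proof -
  have le: "total_length (tl ws) \<le> total_length ws" for ws
    by (cases ws) auto
  have pow: "(total_length (tl ws) + 2) ^ k \<le> (total_length ws + 2) ^ k" for ws k
    by (rule power_mono) (use le in auto)
  from F obtain l where l: "\<And>ws. length ws = m \<Longrightarrow> length (F ws) \<le> (total_length ws + 2) ^ l"
    by (rule polyfun_length) blast
  show ?thesis
  proof (rule polyfunI)
    show "poly_bounded (\<lambda>n. (n + 2) ^ l)"
      by (intro poly_bounded_intros)
    show "length (F (tl ws)) \<le> (total_length ws + 2) ^ l" if "length ws = Suc m" for ws
      by (rule le_trans[OF l pow]) (use that in simp)
  next
    fix ins :: "nat list" and out base :: nat
    assume ins: "length ins = Suc m" "set ins \<subseteq> {..<base}" "out < base" "out \<notin> set ins"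
    then obtain i js where [simp]: "ins = i # js" and "length js = m" "set js \<subseteq> {..<base}" "out \<notin> set js"
      by (cases ins) auto
    with F ins(3) obtain p k where p: "queries p = {}"
      "\<And>s. s out = [] \<Longrightarrow> (\<And>r. r \<ge> base \<Longrightarrow> s r = []) \<Longrightarrow>
         runs p s ((total_length (map s js) + 2) ^ k) (s(out := F (map s js)))"
      by (metis polyfun_prog)
    have "assigns p ins out base (\<lambda>vs. F (tl vs)) (\<lambda>n. (n + 2) ^ k)"
      unfolding assigns_def
    proof (intro conjI allI impI)
      fix s :: state
      assume s: "s out = [] \<and> (\<forall>r\<ge>base. s r = [])"
      show "runs p s ((total_length (map s ins) + 2) ^ k) (s(out := F (tl (map s ins))))"
        by (rule runs_eq[OF p(2)]) (use s pow[of "map s ins" k] in auto)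
    qed (rule p)
    moreover have "poly_bounded (\<lambda>n. (n + 2) ^ k)"
      by (intro poly_bounded_intros)
    ultimately show "\<exists>p T. poly_bounded T \<and> assigns p ins out base (\<lambda>vs. F (tl vs)) T"
      by blast
  qed
qed

lemma polyfun_hd: "polyfun (Suc m) hd"
  by (rule polyfun_cong[OF polyfun_nth[of 0]]) (auto simp: length_Suc_conv)

text \<open>This is Cobham's bounded recursion on notation. Without the length bound the claim would
  fail: a step that doubles the accumulator produces exponential length. The bound ranges over all
  strings \<open>x\<close> because it is applied to every prefix of \<open>X ws\<close>.\<close>

lemma polyfun_fold:
  assumes X: "polyfun m X" and A: "polyfun m A"
    and H: "\<And>b. polyfun (Suc m) (\<lambda>vs. H b (hd vs) (tl vs))"
    and bound: "\<And>ws x. length ws = m \<Longrightarrow>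
      length (fold (\<lambda>b a. H b a ws) x (A ws)) \<le> (length x + total_length ws + 2) ^ k"
  shows "polyfun m (\<lambda>ws. fold (\<lambda>b a. H b a ws) (X ws) (A ws))"
proof -
  from X obtain l where l: "\<And>ws. length ws = m \<Longrightarrow> length (X ws) \<le> (total_length ws + 2) ^ l"
    by (rule polyfun_length) blast
  define S where "S n = ((n + 2) ^ l + n + 2) ^ k" for n :: nat
  have S: "length (fold (\<lambda>b a. H b a ws) x (A ws)) \<le> S (total_length ws)"
    if "length ws = m" "length x \<le> length (X ws)" for ws x
    unfolding S_def by (rule le_trans[OF bound power_mono]) (use that l in \<open>auto intro: le_trans\<close>)
  have poly_S: "poly_bounded S"
    unfolding S_def[abs_def] by (intro poly_bounded_intros)
  show ?thesis
  proof (rule polyfunI)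
    show "poly_bounded S"
      by (rule poly_S)
    show "length (fold (\<lambda>b a. H b a ws) (X ws) (A ws)) \<le> S (total_length ws)" if "length ws = m" for ws
      using S[OF that] by simp
  next
    fix ins :: "nat list" and out base :: nat
    assume ins: "length ins = m" "set ins \<subseteq> {..<base}" "out < base" "out \<notin> set ins"
    then have base: "base \<notin> set ins" "base + 1 \<notin> set ins" "base + 2 \<notin> set ins" "base + 3 \<notin> set ins"
      "base < base + 1" "base + 1 < base + 2" "base + 2 < base + 3"
      "set ins \<subseteq> {..<base + 1}" "set ins \<subseteq> {..<base + 2}"
      and H_ins: "length ((base + 1) # ins) = Suc m" "set ((base + 1) # ins) \<subseteq> {..<base + 3}"
        "base + 2 \<notin> set ((base + 1) # ins)"
      by auto
    from X ins(1) base(8,5,1) obtain px kx where px: "queries px = {}"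
      "\<And>s. s base = [] \<Longrightarrow> (\<And>r. r \<ge> base + 1 \<Longrightarrow> s r = []) \<Longrightarrow>
         runs px s ((total_length (map s ins) + 2) ^ kx) (s(base := X (map s ins)))"
      by (rule polyfun_prog) blast
    from A ins(1) base(9,6,2) obtain pa ka where pa: "queries pa = {}"
      "\<And>s. s (base + 1) = [] \<Longrightarrow> (\<And>r. r \<ge> base + 2 \<Longrightarrow> s r = []) \<Longrightarrow>
         runs pa s ((total_length (map s ins) + 2) ^ ka) (s(base + 1 := A (map s ins)))"
      by (rule polyfun_prog) blast
    have "\<exists>p k. queries p = {} \<and> (\<forall>s. s (base + 2) = [] \<longrightarrow> (\<forall>r \<ge> base + 3. s r = []) \<longrightarrow>
         runs p s ((total_length (map s ((base + 1) # ins)) + 2) ^ k)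
           (s(base + 2 := H b (s (base + 1)) (map s ins))))" for b
      using H[of b] H_ins(1,2) base(7) H_ins(3) by (rule polyfun_prog) (auto simp del: add_2_eq_Suc')
    then obtain ph kh where ph: "\<And>b. queries (ph b) = {}"
      "\<And>b s. s (base + 2) = [] \<Longrightarrow> (\<And>r. r \<ge> base + 3 \<Longrightarrow> s r = []) \<Longrightarrow>
         runs (ph b) s ((length (s (base + 1)) + total_length (map s ins) + 2) ^ kh b)
           (s(base + 2 := H b (s (base + 1)) (map s ins)))"
      by (simp del: add_2_eq_Suc') metis
    \<comment> \<open>Register \<open>base\<close> holds the bits still to be read,
      \<open>base + 1\<close> the accumulator, \<open>base + 2\<close> the new accumulator;
      \<open>base + 3\<close> is scratch space for the move.\<close>
    define step where "step b = Seq (Pop base) (Seq (ph b) (Seq (clear (base + 1)) (move (base + 2) (base + 1) (base + 3))))" for b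
    define loop where "loop = While base (Case base Skip (step False) (step True))"
    \<comment> \<open>\<open>10 * S n + 4\<close> covers \<open>Pop\<close>, \<open>clear\<close>
      and \<open>move\<close>; the other 2 units, subtracted in the bound for \<open>step\<close>,
      pay for \<open>Case\<close> and \<open>While\<close> in one iteration. The exponents differ
      for the two bits, so both powers are added.\<close>
    define B where "B n = (S n + n + 2) ^ kh False + (S n + n + 2) ^ kh True + 10 * S n + 6" for n :: nat
    have step: "runs (step b) s (B (total_length (map s ins)) - 2) (s(base := x, base + 1 := H b (s (base + 1)) (map s ins)))"
      if s: "s base = b # x" "\<And>r. r \<ge> base + 2 \<Longrightarrow> s r = []"
        and le: "length (s (base + 1)) \<le> S (total_length (map s ins))"
          "length (H b (s (base + 1)) (map s ins)) \<le> S (total_length (map s ins))" for s b x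
    proof -
      let ?a = "s (base + 1)" and ?ws = "map s ins"
      let ?s1 = "s(base := x)"
      let ?s2 = "?s1(base + 2 := H b ?a ?ws)"
      let ?s3 = "?s2(base + 1 := [])"
      let ?N = "S (total_length ?ws)"
      have 1: "runs (Pop base) s 1 ?s1"
        by (rule runs_eq[OF runs_Pop]) (use s in auto)
      have "runs (ph b) ?s1 ((length (?s1 (base + 1)) + total_length (map ?s1 ins) + 2) ^ kh b)
          (?s1(base + 2 := H b (?s1 (base + 1)) (map ?s1 ins)))"
        by (rule ph(2)) (use s in auto)
      then have 2: "runs (ph b) ?s1 ((?N + total_length ?ws + 2) ^ kh b) ?s2"
        by (rule runs_eq) (use le base in \<open>auto intro!: power_mono\<close>)
      have 3: "runs (clear (base + 1)) ?s2 (2 * ?N + 1) ?s3"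
        by (rule runs_eq[OF runs_clear]) (use le in auto)
      have 4: "runs (move (base + 2) (base + 1) (base + 3)) ?s3 (8 * ?N + 2) (s(base := x, base + 1 := H b ?a ?ws))"
        by (rule runs_eq[OF runs_move]) (use le s in \<open>auto simp: fun_eq_iff\<close>)
      show ?thesis
        unfolding step_def by (rule runs_mono[OF runs_Seq[OF 1 runs_Seq[OF 2 runs_Seq[OF 3 4]]]])
          (cases b; simp add: B_def)
    qed
    \<comment> \<open>Here \<open>y\<close> is the part already read. It identifies the accumulator
      as an intermediate value of the fold, to which the bound \<open>S\<close> applies.\<close>
    have loop: "runs loop s (B (total_length ws) * length x + 1)
        (s(base := [], base + 1 := fold (\<lambda>b a. H b a ws) (y @ x) (A ws)))"
      if "s base = x" "s (base + 1) = fold (\<lambda>b a. H b a ws) y (A ws)" "\<And>r. r \<ge> base + 2 \<Longrightarrow> s r = []"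
        "map s ins = ws" "length (y @ x) \<le> length (X ws)" for s x y ws
      using that
    proof (induction x arbitrary: s y)
      case Nil
      then have id: "s(base := [], base + 1 := fold (\<lambda>b a. H b a ws) (y @ []) (A ws)) = s"
        by (auto simp: fun_eq_iff)
      show ?case
        unfolding id loop_def using Nil runs_While_end[of s base] by simp
    next
      case (Cons b x)
      let ?h = "\<lambda>b a. H b a ws"
      let ?s = "s(base := x, base + 1 := fold ?h (y @ [b]) (A ws))"
      have len: "length ws = m"
        using Cons.prems(4) ins(1) by auto
      have "length (s (base + 1)) \<le> S (total_length (map s ins))"
        "length (H b (s (base + 1)) (map s ins)) \<le> S (total_length (map s ins))"
        using S[OF len, of y] S[OF len, of "y @ [b]"] Cons.prems by simp_all
      then have "runs (step b) s (B (total_length ws) - 2) ?s"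
        using step[of s b x] Cons.prems by auto
      then have 1: "runs (if b then step True else step False) s (B (total_length ws) - 2) ?s"
        by (cases b) auto
      have 2: "runs loop ?s (B (total_length ws) * length x + 1)
          (?s(base := [], base + 1 := fold ?h ((y @ [b]) @ x) (A ws)))"
        by (rule Cons.IH) (use Cons.prems base in auto)
      have 3: "B (total_length ws) \<ge> 6"
        by (simp add: B_def)
      have "s base \<noteq> []"
        using Cons.prems by simp
      from runs_While_step[OF this runs_Case_Cons[where s = s and r = base, OF Cons.prems(1) 1] 2[unfolded loop_def]]
      show ?case
        unfolding loop_def by (rule runs_eq) (use 3 in \<open>auto simp: fun_eq_iff\<close>)
    qed
    let ?p = "Seq px (Seq pa (Seq loop (move (base + 1) out (base + 2))))"
    let ?T = "\<lambda>n. (n + 2) ^ kx + ((n + 2) ^ ka + ((B n * (n + 2) ^ l + 1) + (8 * S n + 2)))"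
    have "assigns ?p ins out base (\<lambda>ws. fold (\<lambda>b a. H b a ws) (X ws) (A ws)) ?T"
      unfolding assigns_def
    proof (intro conjI allI impI)
      fix s :: state
      assume s: "s out = [] \<and> (\<forall>r\<ge>base. s r = [])"
      define ws where "ws = map s ins"
      have len: "length ws = m"
        using ins(1) by (simp add: ws_def)
      let ?s1 = "s(base := X ws)"
      let ?s2 = "?s1(base + 1 := A ws)"
      let ?R = "fold (\<lambda>b a. H b a ws) (X ws) (A ws)"
      let ?s3 = "s(base + 1 := ?R)"
      have 1: "runs px s ((total_length ws + 2) ^ kx) ?s1"
        unfolding ws_def by (rule px(2)) (use s in auto)
      have 2: "runs pa ?s1 ((total_length ws + 2) ^ ka) ?s2"
        by (rule runs_eq[OF pa(2)]) (use s base ws_def in auto)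
      have "runs loop ?s2 (B (total_length ws) * length (X ws) + 1)
          (?s2(base := [], base + 1 := fold (\<lambda>b a. H b a ws) ([] @ X ws) (A ws)))"
        by (rule loop) (use s base ws_def in auto)
      then have 3: "runs loop ?s2 (B (total_length ws) * (total_length ws + 2) ^ l + 1) ?s3"
        by (rule runs_eq) (use s l[OF len] in \<open>auto simp: fun_eq_iff\<close>)
      have 4: "runs (move (base + 1) out (base + 2)) ?s3 (8 * S (total_length ws) + 2) (s(out := ?R))"
        by (rule runs_eq[OF runs_move]) (use s ins(3) S[OF len, of "X ws"] in \<open>auto simp: fun_eq_iff\<close>)
      show "runs ?p s (?T (total_length (map s ins)))
          (s(out := fold (\<lambda>b a. H b a (map s ins)) (X (map s ins)) (A (map s ins))))"
        using runs_Seq[OF 1 runs_Seq[OF 2 runs_Seq[OF 3 4]]] unfolding ws_def .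
    qed (use px pa ph in \<open>auto simp: loop_def step_def\<close>)
    moreover have "poly_bounded ?T"
      unfolding B_def by (intro poly_bounded_intros poly_S)
    ultimately show "\<exists>p T. poly_bounded T \<and>
        assigns p ins out base (\<lambda>ws. fold (\<lambda>b a. H b a ws) (X ws) (A ws)) T"
      by blast
  qed
qed


section \<open>Clocked simulation of oracle programs\<close>

text \<open>The inequality is strict because the simulation takes an empty clock as a timeout, so
  one bit must be left when the program halts. The leading \<open>True\<close> distinguishes an
  empty output from a timeout.\<close>

definition clocked :: "'q oracle_fun \<Rightarrow> 'q prog \<Rightarrow> bits list \<Rightarrow> nat \<Rightarrow> bits" where
  "clocked ora p ws c = (if \<exists>t<c. \<exists>out. halts_with ora p ws t out
     then True # (THE out. \<exists>t. halts_with ora p ws t out) else [])"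

lemma halts_with_deterministic:
  "halts_with ora p ws t out \<Longrightarrow> halts_with ora p ws t' out' \<Longrightarrow> t = t' \<and> out = out'"
  unfolding halts_with_def using exec_deterministic by metis

lemma clocked_halts:
  assumes "halts_with ora p ws t out" "t < c"
  shows "clocked ora p ws c = True # out"
proof -
  have "(THE out. \<exists>t. halts_with ora p ws t out) = out"
    using assms(1) halts_with_deterministic by blast
  then show ?thesis
    using assms unfolding clocked_def by auto
qed

lemma clocked_not_halts:
  "(\<And>t out. t < c \<Longrightarrow> \<not> halts_with ora p ws t out) \<Longrightarrow> clocked ora p ws c = []"
  unfolding clocked_def by auto

lemma clocked_nonempty:
  assumes "clocked ora p ws c \<noteq> []"
  obtains t out where "t < c" "halts_with ora p ws t out" "clocked ora p ws c = True # out"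
  using assms clocked_halts clocked_not_halts by metis

primrec registers :: "'q prog \<Rightarrow> nat set" where
  "registers Skip = {}"
| "registers (Push r b) = {r}"
| "registers (Pop r) = {r}"
| "registers (Query q r) = {r}"
| "registers (Seq p p') = registers p \<union> registers p'"
| "registers (Case r p p0 p1) = {r} \<union> registers p \<union> registers p0 \<union> registers p1"
| "registers (While r p) = {r} \<union> registers p"

lemma finite_registers: "finite (registers p)"
  by (induction p) auto

lemma finite_queries: "finite (queries p)"
  by (induction p) auto

definition guarded :: "nat \<Rightarrow> unit prog \<Rightarrow> unit prog" where
  "guarded c p = Case c Skip (Seq (Pop c) p) (Seq (Pop c) p)"

lemma queries_guarded [simp]: "queries (guarded c p) = queries p"
  by (auto simp: guarded_def)

text \<open>
  Every elementary step first pops the clock register \<open>c\<close> and is skipped once the clock has run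
  out; a loop tests the clock together with its own register and puts the result into register \<open>g\<close>.
  Register \<open>r\<close> of the simulated program is register \<open>d + r\<close>.
\<close>

definition loop_test :: "nat \<Rightarrow> nat \<Rightarrow> nat \<Rightarrow> unit prog" where
  "loop_test c g r = guarded c (Case r Skip (Push g True) (Push g True))"

primrec clocked_prog :: "('q \<Rightarrow> nat \<Rightarrow> unit prog) \<Rightarrow> nat \<Rightarrow> nat \<Rightarrow> nat \<Rightarrow> 'q prog \<Rightarrow> unit prog" where
  "clocked_prog qp c g d Skip = guarded c Skip"
| "clocked_prog qp c g d (Push r b) = guarded c (Push (d + r) b)"
| "clocked_prog qp c g d (Pop r) = guarded c (Pop (d + r))"
| "clocked_prog qp c g d (Query q r) = guarded c (qp q r)"
| "clocked_prog qp c g d (Seq p p') = Seq (clocked_prog qp c g d p) (clocked_prog qp c g d p')"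
| "clocked_prog qp c g d (Case r p p0 p1) = guarded c (Case (d + r)
     (clocked_prog qp c g d p) (clocked_prog qp c g d p0) (clocked_prog qp c g d p1))"
| "clocked_prog qp c g d (While r p) = Seq (loop_test c g (d + r))
     (While g (Seq (Pop g) (Seq (clocked_prog qp c g d p) (loop_test c g (d + r)))))"

lemma queries_clocked_prog:
  assumes "\<And>q r. r \<in> registers p \<Longrightarrow> q \<in> queries p \<Longrightarrow> queries (qp q r) = {}"
  shows "queries (clocked_prog qp c g d p) = {}"
  using assms by (induction p) (auto simp: loop_test_def)

text \<open>After a timeout the rest of the translated program is still traversed, with every guard
  skipping its step and every loop closing at once. The time for this depends only on the program
  text, and the numbers 10 and 20 are generous estimates for one construct.\<close>

primrec overhead :: "'q prog \<Rightarrow> nat" where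
  "overhead Skip = 10"
| "overhead (Push r b) = 10"
| "overhead (Pop r) = 10"
| "overhead (Query q r) = 10"
| "overhead (Seq p p') = overhead p + overhead p'"
| "overhead (Case r p p0 p1) = overhead p + overhead p0 + overhead p1 + 10"
| "overhead (While r p) = overhead p + 20"

section \<open>Correctness of the simulation, construct by construct\<close>

lemma runs_guarded_Nil: "s c = [] \<Longrightarrow> runs (guarded c p) s 2 s"
  unfolding guarded_def by (rule runs_eq[OF runs_Case_Nil[OF _ runs_Skip]]) auto

lemma runs_guarded_Cons:
  assumes "s c = v # y" "runs p (s(c := y)) b s'"
  shows "runs (guarded c p) s (b + 2) s'"
proof -
  have "runs (Pop c) s 1 (s(c := y))"
    by (rule runs_eq[OF runs_Pop]) (use assms in auto)
  from runs_Seq[OF this assms(2)] have "runs (if v then Seq (Pop c) p else Seq (Pop c) p) s (1 + b) s'"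
    by simp
  from runs_Case_Cons[where s = s and r = c, OF assms(1) this]
  show ?thesis
    unfolding guarded_def by (rule runs_eq) auto
qed

text \<open>A translated loop repeats its test at the end of the body, so a run of the test followed
  by the loop has to be split in order to count the test with the preceding iteration.\<close>

lemma runs_SeqE:
  assumes "runs (Seq p p') s b s''"
  obtains s' b1 b2 where "runs p s b1 s'" "runs p' s' b2 s''" "b1 + b2 \<le> b"
proof -
  obtain t where "t \<le> b" "exec (\<lambda>_ _. []) (Seq p p') s t s''"
    using assms unfolding runs_def by blast
  then obtain s' t1 t2 where "exec (\<lambda>_ _. []) p s t1 s'" "exec (\<lambda>_ _. []) p' s' t2 s''" "t1 + t2 \<le> b"
    by (auto elim: exec.cases)
  with that[of t1 s' t2] show ?thesis
    unfolding runs_def by blast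
qed

text \<open>Register \<open>c\<close> is the clock, \<open>g\<close> the loop flag, and the
  \<open>K\<close> simulated registers start at \<open>d\<close>. \<open>Z\<close> bounds the
  lengths of answers and, being at least 1, also the growth caused by a \<open>Push\<close>;
  \<open>Q\<close> bounds the time for a query and \<open>S\<close> the lengths of registers.
  \<open>X\<close> is the set of queries that may occur, and \<open>s0\<close> is the state of the
  surrounding program.\<close>

locale clocked_simulation =
  fixes ora :: "'q oracle_fun" and qp :: "'q \<Rightarrow> nat \<Rightarrow> unit prog" and X :: "'q set"
    and c g d K Z Q S :: nat and s0 :: state
  assumes layout: "c < d" "g < d" "c \<noteq> g" "s0 g = []"
    and Z: "1 \<le> Z" "\<And>q w. length (ora q w) \<le> Z"
begin

text \<open>Taking all other registers from \<open>s0\<close> makes the preservation of the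
  surrounding state part of every simulation statement.\<close>

definition encode :: "state \<Rightarrow> bits \<Rightarrow> state" where
  "encode \<sigma> y = (\<lambda>i. if i = c then y else if d \<le> i \<and> i < d + K then \<sigma> (i - d) else s0 i)"

lemma encode_simps [simp]:
  "encode \<sigma> y c = y"
  "r < K \<Longrightarrow> encode \<sigma> y (d + r) = \<sigma> r"
  "encode \<sigma> y g = []"
  "(encode \<sigma> y)(c := y') = encode \<sigma> y'"
  "r < K \<Longrightarrow> (encode \<sigma> y)(d + r := w) = encode (\<sigma>(r := w)) y"
  "(encode \<sigma> y)(g := []) = encode \<sigma> y"
  using layout by (auto simp: encode_def fun_eq_iff)

text \<open>Here \<open>e\<close> is the number of simulated steps, and \<open>y'\<close> is empty if the clock has run out.\<close>

definition simulates :: "'q prog \<Rightarrow> unit prog \<Rightarrow> nat \<Rightarrow> state \<Rightarrow> bits \<Rightarrow> bool" where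
  "simulates p p' k \<sigma> y \<longleftrightarrow> (\<exists>\<sigma>' y' e. length y = e + length y' \<and>
     runs p' (encode \<sigma> y) ((Q + k) * e + k) (encode \<sigma>' y') \<and>
     (\<forall>r. length (\<sigma>' r) \<le> length (\<sigma> r) + Z * e) \<and>
     (y' \<noteq> [] \<longrightarrow> exec ora p \<sigma> e \<sigma>') \<and>
     (\<forall>t \<tau>. exec ora p \<sigma> t \<tau> \<longrightarrow> t < length y \<longrightarrow> y' \<noteq> []))"

lemma simulatesE:
  assumes "simulates p p' k \<sigma> y"
  obtains \<sigma>' y' e where "length y = e + length y'"
    "runs p' (encode \<sigma> y) ((Q + k) * e + k) (encode \<sigma>' y')"
    "\<And>r. length (\<sigma>' r) \<le> length (\<sigma> r) + Z * e"
    "y' \<noteq> [] \<longrightarrow> exec ora p \<sigma> e \<sigma>'"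
    "\<And>t \<tau>. exec ora p \<sigma> t \<tau> \<Longrightarrow> t < length y \<Longrightarrow> y' \<noteq> []"
  using assms unfolding simulates_def by blast

lemma simulates_Nil:
  assumes "runs p' (encode \<sigma> []) k (encode \<sigma> [])"
  shows "simulates p p' k \<sigma> []"
  unfolding simulates_def
  by (rule exI[of _ \<sigma>], rule exI[of _ "[]"], rule exI[of _ 0]) (use assms in auto)

lemma simulates_one_step:
  assumes ex: "exec ora p \<sigma> 1 \<sigma>'" and y: "y = v # y1"
    and run: "runs p' (encode \<sigma> y) (Q + k) (encode \<sigma>' y1)"
    and "\<And>r. length (\<sigma>' r) \<le> length (\<sigma> r) + Z"
  shows "simulates p p' k \<sigma> y"
proof -
  have "y1 \<noteq> []" if "exec ora p \<sigma> t \<tau>" "t < length y" for t \<tau>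
    using exec_deterministic[OF ex that(1)] that(2) y by auto
  moreover have "runs p' (encode \<sigma> y) ((Q + k) * 1 + k) (encode \<sigma>' y1)"
    by (rule runs_mono[OF run]) simp
  ultimately show ?thesis
    unfolding simulates_def using assms(1,2,4)
    by (intro exI[of _ \<sigma>'] exI[of _ y1] exI[of _ "1 :: nat"]) simp
qed

lemma simulates_elementary:
  assumes "exec ora p \<sigma> 1 \<sigma>'" "\<And>y. runs p' (encode \<sigma> y) (Q + 1) (encode \<sigma>' y)"
    "\<And>r. length (\<sigma>' r) \<le> length (\<sigma> r) + Z"
  shows "simulates p (guarded c p') 10 \<sigma> y"
proof (cases y)
  case Nil
  then show ?thesis
    by (auto intro!: simulates_Nil runs_eq[OF runs_guarded_Nil])
next
  case (Cons v y1)
  have "runs (guarded c p') (encode \<sigma> y) (Q + 1 + 2) (encode \<sigma>' y1)"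
    by (rule runs_guarded_Cons) (use Cons assms(2) in auto)
  then show ?thesis
    by (intro simulates_one_step[OF assms(1) Cons _ assms(3)]) (erule runs_mono, simp)
qed

text \<open>The second program has to be simulated only from states within reach of the first:
  \<open>e\<close> spent clock bits allow at most \<open>Z * e\<close> additional bits in a
  register. If the clock runs out in the first part, the second part is run on the empty
  clock.\<close>

lemma simulates_Seq:
  assumes 1: "simulates p1 p1' k1 \<sigma> y"
    and 2: "\<And>\<sigma>' y' e. length y = e + length y' \<Longrightarrow>
      (\<And>r. length (\<sigma>' r) \<le> length (\<sigma> r) + Z * e) \<Longrightarrow> simulates p2 p2' k2 \<sigma>' y'"
  shows "simulates (Seq p1 p2) (Seq p1' p2') (k1 + k2) \<sigma> y"
proof -
  obtain \<sigma>1 y1 e1 where s1: "length y = e1 + length y1"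
      "runs p1' (encode \<sigma> y) ((Q + k1) * e1 + k1) (encode \<sigma>1 y1)"
      "\<And>r. length (\<sigma>1 r) \<le> length (\<sigma> r) + Z * e1"
      "y1 \<noteq> [] \<longrightarrow> exec ora p1 \<sigma> e1 \<sigma>1"
      "\<And>t \<tau>. exec ora p1 \<sigma> t \<tau> \<Longrightarrow> t < length y \<Longrightarrow> y1 \<noteq> []"
    using 1 by (rule simulatesE) blast
  obtain \<sigma>2 y2 e2 where s2: "length y1 = e2 + length y2"
      "runs p2' (encode \<sigma>1 y1) ((Q + k2) * e2 + k2) (encode \<sigma>2 y2)"
      "\<And>r. length (\<sigma>2 r) \<le> length (\<sigma>1 r) + Z * e2"
      "y2 \<noteq> [] \<longrightarrow> exec ora p2 \<sigma>1 e2 \<sigma>2"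
      "\<And>t \<tau>. exec ora p2 \<sigma>1 t \<tau> \<Longrightarrow> t < length y1 \<Longrightarrow> y2 \<noteq> []"
    using 2[OF s1(1,3)] by (rule simulatesE) blast
  show ?thesis
    unfolding simulates_def
  proof (intro exI conjI allI impI)
    show "length y = (e1 + e2) + length y2"
      using s1(1) s2(1) by simp
    show "runs (Seq p1' p2') (encode \<sigma> y) ((Q + (k1 + k2)) * (e1 + e2) + (k1 + k2)) (encode \<sigma>2 y2)"
      by (rule runs_mono[OF runs_Seq[OF s1(2) s2(2)]]) (simp add: algebra_simps)
    show "length (\<sigma>2 r) \<le> length (\<sigma> r) + Z * (e1 + e2)" for r
      using s1(3)[of r] s2(3)[of r] by (simp add: algebra_simps)
    show "exec ora (Seq p1 p2) \<sigma> (e1 + e2) \<sigma>2" if "y2 \<noteq> []"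
      using that s1(4) s2(1,4) by (intro exec.Seq[of _ _ _ _ \<sigma>1]) auto
    \<comment> \<open>The first part of a real run is short enough to leave a nonempty clock;
      determinism then identifies its end with the simulated state, so the second part starts from
      the right place.\<close>
    show "y2 \<noteq> []" if "exec ora (Seq p1 p2) \<sigma> t \<tau>" "t < length y" for t \<tau>
    proof -
      from that(1) obtain \<tau>1 t1 t2 where t: "t = t1 + t2" "exec ora p1 \<sigma> t1 \<tau>1" "exec ora p2 \<tau>1 t2 \<tau>"
        by (auto elim: exec.cases)
      with s1(5) that(2) have "y1 \<noteq> []"
        by (metis add_lessD1)
      with s1(4) t(2) exec_deterministic have "t1 = e1" "\<tau>1 = \<sigma>1"
        by metis+
      with t s1(1) that(2) s2(5) show ?thesis
        by auto
    qed
  qed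
qed

lemma simulates_Case:
  assumes r: "r < K"
    and sim: "\<And>v y1. y = v # y1 \<Longrightarrow> \<sigma> r = [] \<Longrightarrow> simulates p p' k \<sigma> y1"
      "\<And>v y1 w. y = v # y1 \<Longrightarrow> \<sigma> r = False # w \<Longrightarrow> simulates p0 p0' k \<sigma> y1"
      "\<And>v y1 w. y = v # y1 \<Longrightarrow> \<sigma> r = True # w \<Longrightarrow> simulates p1 p1' k \<sigma> y1"
  shows "simulates (Case r p p0 p1) (guarded c (Case (d + r) p' p0' p1')) (k + 10) \<sigma> y"
proof (cases y)
  case Nil
  then show ?thesis
    by (auto intro!: simulates_Nil runs_eq[OF runs_guarded_Nil])
next
  case (Cons v y1)
  \<comment> \<open>Naming the selected branch allows the three cases to be treated
    together.\<close>
  define pb where "pb = (case \<sigma> r of [] \<Rightarrow> p | b # _ \<Rightarrow> if b then p1 else p0)"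
  define pb' where "pb' = (case \<sigma> r of [] \<Rightarrow> p' | b # _ \<Rightarrow> if b then p1' else p0')"
  have "simulates pb pb' k \<sigma> y1"
    using sim[OF Cons] by (auto simp: pb_def pb'_def split: list.split)
  then obtain \<sigma>1 y' e where s1: "length y1 = e + length y'"
      "runs pb' (encode \<sigma> y1) ((Q + k) * e + k) (encode \<sigma>1 y')"
      "\<And>r. length (\<sigma>1 r) \<le> length (\<sigma> r) + Z * e"
      "y' \<noteq> [] \<longrightarrow> exec ora pb \<sigma> e \<sigma>1"
      "\<And>t \<tau>. exec ora pb \<sigma> t \<tau> \<Longrightarrow> t < length y1 \<Longrightarrow> y' \<noteq> []"
    by (rule simulatesE) blast
  have "runs (Case (d + r) p' p0' p1') (encode \<sigma> y1) ((Q + k) * e + k + 1) (encode \<sigma>1 y')"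
  proof (cases "\<sigma> r")
    case Nil
    then show ?thesis
      using s1(2) r by (intro runs_Case_Nil) (auto simp: pb'_def)
  next
    case (Cons b w)
    then show ?thesis
      using s1(2) r by (intro runs_Case_Cons[of _ _ b w]) (auto simp: pb'_def)
  qed
  then have run: "runs (guarded c (Case (d + r) p' p0' p1')) (encode \<sigma> y) ((Q + k) * e + k + 1 + 2) (encode \<sigma>1 y')"
    by (intro runs_guarded_Cons[of _ _ v y1]) (use Cons in auto)
  show ?thesis
    unfolding simulates_def
  proof (intro exI conjI allI impI)
    show "length y = (e + 1) + length y'"
      using s1(1) Cons by simp
    show "runs (guarded c (Case (d + r) p' p0' p1')) (encode \<sigma> y) ((Q + (k + 10)) * (e + 1) + (k + 10)) (encode \<sigma>1 y')"
      by (rule runs_mono[OF run]) (simp add: algebra_simps)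
    show "length (\<sigma>1 r) \<le> length (\<sigma> r) + Z * (e + 1)" for r
      using s1(3)[of r] by simp
    show "exec ora (Case r p p0 p1) \<sigma> (e + 1) \<sigma>1" if "y' \<noteq> []"
      using s1(4) that exec.Case_Nil[of \<sigma> r ora p e \<sigma>1] exec.Case_0[of \<sigma> r _ ora p0 e \<sigma>1]
        exec.Case_1[of \<sigma> r _ ora p1 e \<sigma>1]
      by (auto simp: pb_def split: list.splits if_splits)
    show "y' \<noteq> []" if "exec ora (Case r p p0 p1) \<sigma> t \<tau>" "t < length y" for t \<tau>
    proof -
      from that(1) obtain t' where "t = t' + 1" "exec ora pb \<sigma> t' \<tau>"
        by cases (auto simp: pb_def)
      with s1(5) that(2) Cons show ?thesis
        by auto
    qed
  qed
qed

text \<open>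
  A step uses up one bit of the clock and lengthens a register by at most \<open>Z\<close>, so the bound by \<open>S\<close>
  is invariant.
\<close>

lemma simulates_While:
  assumes r: "r < K"
    and body: "\<And>\<sigma> y. (\<And>r. length (\<sigma> r) + Z * length y \<le> S) \<Longrightarrow> simulates p p' k \<sigma> y"
    and bound: "\<And>r. length (\<sigma> r) + Z * length y \<le> S"
  shows "simulates (While r p) (Seq (loop_test c g (d + r))
     (While g (Seq (Pop g) (Seq p' (loop_test c g (d + r)))))) (k + 20) \<sigma> y"
  using bound
\<comment> \<open>The induction is on the clock and not on an execution, since the simulated loop
  may diverge. Every nonfinal loop test spends a bit, so the clock gets strictly shorter.\<close>
proof (induction "length y" arbitrary: \<sigma> y rule: less_induct)
  case less
  define test where "test = loop_test c g (d + r)"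
  define loop where "loop = While g (Seq (Pop g) (Seq p' test))"
  note fold = test_def[symmetric] loop_def[symmetric]
  have exit: "runs loop (encode \<sigma> y) 1 (encode \<sigma> y)" for \<sigma> y
    unfolding loop_def by (rule runs_While_end) simp
  show ?case
    unfolding fold
  proof (cases y)
    case Nil
    have "runs test (encode \<sigma> []) 2 (encode \<sigma> [])"
      unfolding test_def loop_test_def by (rule runs_guarded_Nil) simp
    from runs_Seq[OF this exit] show "simulates (While r p) (Seq test loop) (k + 20) \<sigma> y"
      unfolding Nil by (intro simulates_Nil) (erule runs_mono, simp)
  next
    case y: (Cons v y1)
    show "simulates (While r p) (Seq test loop) (k + 20) \<sigma> y"
    proof (cases "\<sigma> r")
      case Nil
      have ex: "exec ora (While r p) \<sigma> 1 \<sigma>"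
        using Nil by (rule exec.While_end)
      have "runs test (encode \<sigma> y) (1 + 1 + 2) (encode \<sigma> y1)"
        unfolding test_def loop_test_def
        by (intro runs_guarded_Cons[of _ _ v y1] runs_Case_Nil) (use y Nil r runs_Skip in auto)
      from runs_Seq[OF this exit] show ?thesis
        by (intro simulates_one_step[OF ex y]) (erule runs_mono, simp_all)
    next
      case (Cons b w)
      have "length (\<sigma> r) + Z * length y1 \<le> S" for r
        using less.prems[of r] y by simp
      from body[of \<sigma> y1, OF this] obtain \<sigma>1 y2 e1 where s1: "length y1 = e1 + length y2"
        "runs p' (encode \<sigma> y1) ((Q + k) * e1 + k) (encode \<sigma>1 y2)"
        "\<And>r. length (\<sigma>1 r) \<le> length (\<sigma> r) + Z * e1"
        "y2 \<noteq> [] \<longrightarrow> exec ora p \<sigma> e1 \<sigma>1"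
        "\<And>t \<tau>. exec ora p \<sigma> t \<tau> \<Longrightarrow> t < length y1 \<Longrightarrow> y2 \<noteq> []"
        by (rule simulatesE) blast
      have "length (\<sigma>1 r) + Z * length y2 \<le> S" for r
        using less.prems[of r] s1(3)[of r] s1(1) y by (simp add: algebra_simps)
      moreover have "length y2 < length y"
        using s1(1) y by simp
      ultimately have "simulates (While r p) (Seq test loop) (k + 20) \<sigma>1 y2"
        using less.hyps unfolding fold by blast
      then obtain \<sigma>2 y3 e2 where s2: "length y2 = e2 + length y3"
        "runs (Seq test loop) (encode \<sigma>1 y2) ((Q + (k + 20)) * e2 + (k + 20)) (encode \<sigma>2 y3)"
        "\<And>r. length (\<sigma>2 r) \<le> length (\<sigma>1 r) + Z * e2"
        "y3 \<noteq> [] \<longrightarrow> exec ora (While r p) \<sigma>1 e2 \<sigma>2"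
        "\<And>t \<tau>. exec ora (While r p) \<sigma>1 t \<tau> \<Longrightarrow> t < length y2 \<Longrightarrow> y3 \<noteq> []"
        by (rule simulatesE) blast
      \<comment> \<open>The induction hypothesis runs the test before the loop, whereas the loop has
        the test as the last part of its body; the run is split here and regrouped below.\<close>
      from s2(2) obtain s3 b1 b2 where s3: "runs test (encode \<sigma>1 y2) b1 s3"
        "runs loop s3 b2 (encode \<sigma>2 y3)" "b1 + b2 \<le> (Q + (k + 20)) * e2 + (k + 20)"
        by (rule runs_SeqE)
      let ?s = "(encode \<sigma> y1)(g := [True])"
      have "runs (if b then Push g True else Push g True) (encode \<sigma> y1) 1 ?s"
        using runs_Push[of g True "encode \<sigma> y1"] by simp
      then have 1: "runs test (encode \<sigma> y) (1 + 1 + 2) ?s"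
        unfolding test_def loop_test_def
        by (intro runs_guarded_Cons[of _ _ v y1] runs_Case_Cons[of _ _ b w]) (use y Cons r in auto)
      have "runs (Pop g) ?s 1 (encode \<sigma> y1)"
        by (rule runs_eq[OF runs_Pop]) auto
      from runs_Seq[OF this runs_Seq[OF s1(2) s3(1)]]
      have 2: "runs loop ?s (1 + ((Q + k) * e1 + k + b1) + b2 + 1) (encode \<sigma>2 y3)"
        unfolding loop_def by (rule runs_While_step[rotated]) (use s3(2) loop_def in auto)
      show ?thesis
        unfolding simulates_def
      proof (intro exI conjI allI impI)
        show "length y = (e1 + e2 + 1) + length y3"
          using s1(1) s2(1) y by simp
        show "runs (Seq test loop) (encode \<sigma> y) ((Q + (k + 20)) * (e1 + e2 + 1) + (k + 20)) (encode \<sigma>2 y3)"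
          by (rule runs_mono[OF runs_Seq[OF 1 2]]) (use s3(3) in \<open>simp add: algebra_simps\<close>)
        show "length (\<sigma>2 r) \<le> length (\<sigma> r) + Z * (e1 + e2 + 1)" for r
          using s1(3)[of r] s2(3)[of r] by (simp add: algebra_simps)
        show "exec ora (While r p) \<sigma> (e1 + e2 + 1) \<sigma>2" if "y3 \<noteq> []"
          using that Cons s1(4) s2(1,4) by (intro exec.While_step[of _ _ _ _ _ \<sigma>1]) auto
        show "y3 \<noteq> []" if ex: "exec ora (While r p) \<sigma> t \<tau>" "t < length y" for t \<tau>
        proof -
          from ex(1) Cons obtain \<tau>1 t1 t2 where t: "t = t1 + t2 + 1" "exec ora p \<sigma> t1 \<tau>1"
              "exec ora (While r p) \<tau>1 t2 \<tau>"
            by cases auto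
          with s1(5) ex(2) y have "y2 \<noteq> []"
            by (auto dest: s1(5))
          with s1(4) t(2) exec_deterministic have "t1 = e1" "\<tau>1 = \<sigma>1"
            by metis+
          with t s1(1) ex(2) y s2(5) show ?thesis
            by auto
        qed
      qed
    qed
  qed
qed

lemma simulates_mono:
  assumes "simulates p p' k \<sigma> y" "k \<le> k'"
  shows "simulates p p' k' \<sigma> y"
proof -
  have "(Q + k) * e + k \<le> (Q + k') * e + k'" for e
    using assms(2) by (intro add_mono mult_le_mono) auto
  with assms(1) show ?thesis
    unfolding simulates_def by (elim ex_forward conj_forward) (auto intro: runs_mono)
qed

text \<open>Queries are the only steps whose cost depends on the data. A time bound \<open>Q\<close>
  for them on registers of length at most \<open>S\<close> suffices, because the sum of a register
  length and \<open>Z\<close> times the remaining clock never increases.\<close>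

lemma simulates_clocked_prog:
  assumes queries: "\<And>q r \<sigma> y. q \<in> X \<Longrightarrow> r < K \<Longrightarrow> length (\<sigma> r) \<le> S \<Longrightarrow>
      runs (qp q r) (encode \<sigma> y) Q (encode (\<sigma>(r := ora q (\<sigma> r))) y)"
    and "queries p \<subseteq> X" "registers p \<subseteq> {..<K}"
    and "\<And>r. length (\<sigma> r) + Z * length y \<le> S"
  shows "simulates p (clocked_prog qp c g d p) (overhead p) \<sigma> y"
  using assms(2-)
proof (induction p arbitrary: \<sigma> y)
  case Skip
  then show ?case
    by (auto intro!: simulates_elementary exec.Skip runs_eq[OF runs_Skip])
next
  case (Push r b)
  then show ?case
    using Z(1) by (auto intro!: simulates_elementary exec.Push runs_eq[OF runs_Push])
next
  case (Pop r)
  then show ?case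
    by (auto intro!: simulates_elementary exec.Pop runs_eq[OF runs_Pop])
next
  case (Query q r)
  have "length (\<sigma> r) \<le> S"
    using Query.prems(3)[of r] by simp
  with Query.prems have run: "runs (qp q r) (encode \<sigma> y) Q (encode (\<sigma>(r := ora q (\<sigma> r))) y)" for y
    by (intro queries) auto
  show ?case
    unfolding clocked_prog.simps overhead.simps
  proof (rule simulates_elementary[OF exec.Query])
    show "runs (qp q r) (encode \<sigma> y) (Q + 1) (encode (\<sigma>(r := ora q (\<sigma> r))) y)" for y
      by (rule runs_mono[OF run]) simp
    show "length ((\<sigma>(r := ora q (\<sigma> r))) i) \<le> length (\<sigma> i) + Z" for i
      using Z(2)[of q "\<sigma> r"] by simp
  qed
next
  case (Seq p1 p2)
  show ?case
    unfolding clocked_prog.simps overhead.simps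
  proof (rule simulates_Seq)
    show "simulates p1 (clocked_prog qp c g d p1) (overhead p1) \<sigma> y"
      by (rule Seq.IH(1)) (use Seq.prems in auto)
    fix \<sigma>' :: state and y' :: bits and e
    assume *: "length y = e + length y'" "\<And>r. length (\<sigma>' r) \<le> length (\<sigma> r) + Z * e"
    have "length (\<sigma>' r) + Z * length y' \<le> S" for r
      using Seq.prems(3)[of r] * (2)[of r] *(1) by (simp add: algebra_simps)
    then show "simulates p2 (clocked_prog qp c g d p2) (overhead p2) \<sigma>' y'"
      using Seq.prems by (intro Seq.IH(2)) auto
  qed
next
  case (Case r p p0 p1)
  have bound: "length (\<sigma> r) + Z * length y1 \<le> S" if "y = v # y1" for r v y1
    using Case.prems(3)[of r] that by simp
  show ?case
    unfolding clocked_prog.simps overhead.simps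
  proof (rule simulates_Case)
    show "r < K"
      using Case.prems by auto
    fix v y1
    assume y: "y = v # y1"
    show "simulates p (clocked_prog qp c g d p) (overhead p + overhead p0 + overhead p1) \<sigma> y1"
      by (rule simulates_mono[OF Case.IH(1)]) (use Case.prems bound[OF y] in auto)
    show "simulates p0 (clocked_prog qp c g d p0) (overhead p + overhead p0 + overhead p1) \<sigma> y1"
      by (rule simulates_mono[OF Case.IH(2)]) (use Case.prems bound[OF y] in auto)
    show "simulates p1 (clocked_prog qp c g d p1) (overhead p + overhead p0 + overhead p1) \<sigma> y1"
      by (rule simulates_mono[OF Case.IH(3)]) (use Case.prems bound[OF y] in auto)
  qed
next
  case (While r p)
  show ?case
    unfolding clocked_prog.simps overhead.simps
    by (rule simulates_While) (use While in auto)
qed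

end


section \<open>The clocked simulation as a polynomial-time function\<close>

text \<open>A step adds at most one bit to a register or replaces its contents by an answer of
  length at most \<open>Z\<close>. This bounds the output of a clocked run.\<close>

lemma exec_length:
  assumes "exec ora p s t s'" "1 \<le> Z" "\<And>q w. length (ora q w) \<le> Z"
  shows "length (s' r) \<le> length (s r) + Z * t"
  using assms(1)
proof (induction)
  case (Query q i s)
  then show ?case
    using assms(3)[of q "s i"] by simp
next
  case (While_step s i p t s' t' s'')
  then show ?case
    using assms(2) by (simp add: algebra_simps)
qed (use assms(2) in \<open>auto simp: algebra_simps\<close>)

primrec clear_range :: "nat \<Rightarrow> nat \<Rightarrow> unit prog" where
  "clear_range d 0 = Skip"
| "clear_range d (Suc K) = Seq (clear_range d K) (clear (d + K))"

lemma queries_clear_range [simp]: "queries (clear_range d K) = {}"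
  by (induction K) auto

lemma runs_clear_range:
  assumes "\<And>r. r < K \<Longrightarrow> length (s (d + r)) \<le> S"
  shows "runs (clear_range d K) s ((2 * S + 1) * K + 1) (\<lambda>r. if d \<le> r \<and> r < d + K then [] else s r)"
  using assms
proof (induction K)
  case 0
  show ?case
    unfolding clear_range.simps by (rule runs_eq[OF runs_Skip]) (auto simp: fun_eq_iff)
next
  case (Suc K)
  let ?s = "\<lambda>r. if d \<le> r \<and> r < d + K then [] else s r"
  have 1: "runs (clear_range d K) s ((2 * S + 1) * K + 1) ?s"
    by (rule Suc.IH) (use Suc.prems in auto)
  have 2: "runs (clear (d + K)) ?s (2 * S + 1) (?s(d + K := []))"
    by (rule runs_mono[OF runs_clear]) (use Suc.prems[of K] in auto)
  show ?case
    unfolding clear_range.simps by (rule runs_eq[OF runs_Seq[OF 1 2]]) (auto simp: fun_eq_iff)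
qed

lemma poly_bounded_sum:
  "finite A \<Longrightarrow> (\<And>i. i \<in> A \<Longrightarrow> poly_bounded (f i)) \<Longrightarrow> poly_bounded (\<lambda>n. \<Sum>i\<in>A. f i n)"
  by (induction A rule: finite_induct) (auto intro: poly_bounded_intros)

lemma setup_prog:
  assumes "\<And>F. F \<in> set Fs \<Longrightarrow> polyfun m F" "length ins = m" "set ins \<subseteq> {..<d}"
  shows "\<exists>p T. poly_bounded T \<and> queries p = {} \<and> (\<forall>s. (\<forall>r\<ge>d. s r = []) \<longrightarrow>
    runs p s (T (total_length (map s ins)))
      (\<lambda>r. if d \<le> r \<and> r < d + length Fs then (Fs ! (r - d)) (map s ins) else s r))"
  using assms(1)
proof (induction Fs rule: rev_induct)
  case Nil
  have "runs Skip s 1 (\<lambda>r. if d \<le> r \<and> r < d + length [] then ([] ! (r - d)) (map s ins) else s r)" for s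
    by (rule runs_eq[OF runs_Skip]) (auto simp: fun_eq_iff)
  then show ?case
    by (intro exI[of _ Skip] exI[of _ "\<lambda>_. 1"] conjI allI impI poly_bounded_const) simp_all
next
  case (snoc F Fs)
  let ?val = "\<lambda>Fs s r. if d \<le> r \<and> r < d + length Fs then (Fs ! (r - d)) (map s ins) else s r"
  let ?j = "d + length Fs"
  from snoc obtain p T where p: "poly_bounded T" "queries p = {}"
    "\<And>s. (\<And>r. r \<ge> d \<Longrightarrow> s r = []) \<Longrightarrow> runs p s (T (total_length (map s ins))) (?val Fs s)"
    by (auto simp del: length_append)
  have "polyfun m F"
    using snoc.prems by simp
  then obtain pf k where pf: "queries pf = {}"
    "\<And>s. s ?j = [] \<Longrightarrow> (\<And>r. r \<ge> ?j + 1 \<Longrightarrow> s r = []) \<Longrightarrow>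
       runs pf s ((total_length (map s ins) + 2) ^ k) (s(?j := F (map s ins)))"
    by (rule polyfun_prog[of m F ins "?j + 1" ?j]) (use assms(2,3) in auto)
  have "runs (Seq p pf) s (T (total_length (map s ins)) + (total_length (map s ins) + 2) ^ k) (?val (Fs @ [F]) s)"
    if s: "\<forall>r\<ge>d. s r = []" for s
  proof -
    have 1: "runs p s (T (total_length (map s ins))) (?val Fs s)"
      by (rule p(3)) (use s in auto)
    have same: "map (?val Fs s) ins = map s ins"
      using assms(3) by auto
    have "runs pf (?val Fs s) ((total_length (map (?val Fs s) ins) + 2) ^ k) ((?val Fs s)(?j := F (map (?val Fs s) ins)))"
      by (rule pf(2)) (use s in auto)
    then have 2: "runs pf (?val Fs s) ((total_length (map s ins) + 2) ^ k) ((?val Fs s)(?j := F (map s ins)))"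
      unfolding same .
    show ?thesis
      by (rule runs_eq[OF runs_Seq[OF 1 2]]) (auto simp: fun_eq_iff nth_append)
  qed
  moreover have "poly_bounded (\<lambda>n. T n + (n + 2) ^ k)"
    by (intro poly_bounded_intros p)
  moreover have "queries (Seq p pf) = {}"
    using p pf by simp
  ultimately show ?case
    by blast
qed

lemma polyfun_list_length:
  assumes "\<And>F. F \<in> set Fs \<Longrightarrow> polyfun m F"
  shows "\<exists>T. poly_bounded T \<and> (\<forall>ws. length ws = m \<longrightarrow> total_length (map (\<lambda>F. F ws) Fs) \<le> T (total_length ws))"
  using assms
proof (induction Fs)
  case Nil
  then show ?case
    using poly_bounded_const[of 0] by auto
next
  case (Cons F Fs)
  then obtain T where T: "poly_bounded T"
    "\<And>ws. length ws = m \<Longrightarrow> total_length (map (\<lambda>F. F ws) Fs) \<le> T (total_length ws)"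
    by auto
  have "polyfun m F"
    using Cons.prems by simp
  then obtain l where "\<And>ws. length ws = m \<Longrightarrow> length (F ws) \<le> (total_length ws + 2) ^ l"
    by (rule polyfun_length) blast
  with T(2) have "\<forall>ws. length ws = m \<longrightarrow> total_length (map (\<lambda>F. F ws) (F # Fs)) \<le> (total_length ws + 2) ^ l + T (total_length ws)"
    by (simp add: add_mono)
  moreover have "poly_bounded (\<lambda>n. (n + 2) ^ l + T n)"
    by (intro poly_bounded_intros T)
  ultimately show ?case
    by blast
qed

lemma length_initial_le: "length (initial ws r) \<le> total_length ws"
  by (simp add: initial_def length_nth_le_total_length)

text \<open>The bound on answers depends on the arguments \<open>ws\<close> only, not on the query
  string. Otherwise answers could, for example, square in length from one query to the next, and the
  state would outgrow every polynomial in the clock.\<close>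

lemma polyfun_clocked:
  fixes p :: "'q prog"
  assumes CL: "polyfun m CL"
    and Fs: "\<And>F. F \<in> set Fs \<Longrightarrow> polyfun m F"
    and ora: "\<And>q. polyfun (Suc m) (\<lambda>vs. ora q (hd vs) (tl vs))"
    and ora_length: "\<And>q w ws. length ws = m \<Longrightarrow> length (ora q w ws) \<le> (total_length ws + 2) ^ z"
  shows "polyfun m (\<lambda>ws. clocked (\<lambda>q w. ora q w ws) p (map (\<lambda>F. F ws) Fs) (length (CL ws)))"
proof -
  from CL obtain l where l: "\<And>ws. length ws = m \<Longrightarrow> length (CL ws) \<le> (total_length ws + 2) ^ l"
    by (rule polyfun_length) blast
  from polyfun_list_length[of Fs m] Fs obtain TI where TI: "poly_bounded TI"
    "\<And>ws. length ws = m \<Longrightarrow> total_length (map (\<lambda>F. F ws) Fs) \<le> TI (total_length ws)"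
    by blast
  define Z where "Z n = (n + 2) ^ z" for n :: nat
  have Z: "1 \<le> Z (total_length ws)" "length (ora q w ws) \<le> Z (total_length ws)" if "length ws = m" for q w ws
    using ora_length[OF that, of q w] by (auto simp: Z_def)
  \<comment> \<open>Initial length plus \<open>Z\<close> for every bit of the clock, an upper bound
    for each simulated register at all times.\<close>
  define S where "S n = TI n + Z n * (n + 2) ^ l" for n :: nat
  have poly_S: "poly_bounded S"
    unfolding S_def[abs_def] Z_def by (intro poly_bounded_intros TI)
  have S: "length (initial (map (\<lambda>F. F ws) Fs) r) + Z (total_length ws) * length (CL ws) \<le> S (total_length ws)"
    if "length ws = m" for ws r
    unfolding S_def
    by (intro add_mono mult_le_mono le_trans[OF length_initial_le TI(2)] l order.refl that)
  show ?thesis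
  proof (rule polyfunI)
    show "poly_bounded (\<lambda>n. S n + 1)"
      by (intro poly_bounded_intros poly_S)
    fix ws :: "bits list"
    assume len: "length ws = m"
    let ?out = "clocked (\<lambda>q w. ora q w ws) p (map (\<lambda>F. F ws) Fs) (length (CL ws))"
    show "length ?out \<le> S (total_length ws) + 1"
    proof (cases "?out = []")
      case False
      then obtain t out where t: "t < length (CL ws)"
        "halts_with (\<lambda>q w. ora q w ws) p (map (\<lambda>F. F ws) Fs) t out" "?out = True # out"
        by (rule clocked_nonempty)
      from t(2) obtain s where "exec (\<lambda>q w. ora q w ws) p (initial (map (\<lambda>F. F ws) Fs)) t s" "s 0 = out"
        unfolding halts_with_def by blast
      with exec_length[OF this(1), of "Z (total_length ws)" 0] Z[OF len]
      have "length out \<le> length (initial (map (\<lambda>F. F ws) Fs) 0) + Z (total_length ws) * t"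
        by auto
      also have "\<dots> \<le> length (initial (map (\<lambda>F. F ws) Fs) 0) + Z (total_length ws) * length (CL ws)"
        using t(1) by simp
      also have "\<dots> \<le> S (total_length ws)"
        by (rule S[OF len])
      finally show ?thesis
        using t(3) by simp
    qed simp
  next
    fix ins :: "nat list" and out base :: nat
    assume ins: "length ins = m" "set ins \<subseteq> {..<base}" "out < base" "out \<notin> set ins"
    \<comment> \<open>Layout: clock, loop flag, \<open>K\<close> simulated registers from
      \<open>d\<close> on, then \<open>D\<close> for the answer to a query, and scratch space for
      the query programs above \<open>D\<close>.\<close>
    define c where "c = base"
    define g where "g = base + 1"
    define d where "d = base + 2"
    obtain K0 where "registers p \<subseteq> {..<K0}"
      using finite_registers[of p] unfolding finite_nat_set_iff_bounded by blast
    \<comment> \<open>The window has room for all registers of \<open>p\<close> and for all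
      arguments; the \<open>+ 1\<close> ensures that register 0, the output, is inside it.\<close>
    define K where "K = K0 + length Fs + 1"
    define D where "D = d + K"
    have K: "registers p \<subseteq> {..<K}" "length Fs < K" "0 < K"
      using \<open>registers p \<subseteq> {..<K0}\<close> by (auto simp: K_def)
    define query_prog where "query_prog q r pq k \<longleftrightarrow> queries pq = {} \<and> (\<forall>s. s D = [] \<longrightarrow>
        (\<forall>i\<ge>D + 1. s i = []) \<longrightarrow>
          runs pq s ((length (s (d + r)) + total_length (map s ins) + 2) ^ k)
            (s(D := ora q (s (d + r)) (map s ins))))" for q r pq k
    have "\<exists>pq k. r < K \<longrightarrow> query_prog q r pq k" for q r
    proof (cases "r < K")
      case True
      have lay: "length ((d + r) # ins) = Suc m" "set ((d + r) # ins) \<subseteq> {..<D + 1}" "D < D + 1"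
         "D \<notin> set ((d + r) # ins)"
        using ins True by (auto simp: d_def D_def)
      obtain pq k where "queries pq = {}"
        "\<And>s. s D = [] \<Longrightarrow> (\<And>i. i \<ge> D + 1 \<Longrightarrow> s i = []) \<Longrightarrow>
          runs pq s ((total_length (map s ((d + r) # ins)) + 2) ^ k)
            (s(D := ora q (hd (map s ((d + r) # ins))) (tl (map s ((d + r) # ins)))))"
        using ora[of q] lay by (rule polyfun_prog) blast
      then show ?thesis
        by (intro exI[of _ pq] exI[of _ k]) (simp add: query_prog_def)
    qed auto
    then obtain pq kq where "\<And>q r. r < K \<Longrightarrow> query_prog q r (pq q r) (kq q r)"
      using that[of "\<lambda>q r. fst (SOME x. r < K \<longrightarrow> query_prog q r (fst x) (snd x))"
        "\<lambda>q r. snd (SOME x. r < K \<longrightarrow> query_prog q r (fst x) (snd x))"]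
      by (metis (mono_tags, lifting) fst_conv snd_conv someI_ex)
    then have pq: "\<And>q r. r < K \<Longrightarrow> queries (pq q r) = {}"
      "\<And>q r s. r < K \<Longrightarrow> s D = [] \<Longrightarrow> (\<And>i. i \<ge> D + 1 \<Longrightarrow> s i = []) \<Longrightarrow>
         runs (pq q r) s ((length (s (d + r)) + total_length (map s ins) + 2) ^ kq q r)
           (s(D := ora q (s (d + r)) (map s ins)))"
      unfolding query_prog_def by simp_all
    define qp where "qp q r = Seq (pq q r) (Seq (clear (d + r)) (move D (d + r) (D + 1)))" for q r
    \<comment> \<open>The exponents vary with the query and the register, but only finitely many
      pairs occur, so their sum is a single polynomial. The remaining terms pay for emptying the
      queried register and for moving the answer into it.\<close>
    define Q where "Q n = (\<Sum>q\<in>queries p. \<Sum>r<K. (S n + n + 2) ^ kq q r) + (2 * S n + 1 + (8 * Z n + 2))" for n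
    have poly_Q: "poly_bounded Q"
      unfolding Q_def[abs_def] Z_def by (intro poly_bounded_intros poly_bounded_sum poly_S finite_queries) auto
    obtain pc kc where pc: "queries pc = {}"
      "\<And>s. s c = [] \<Longrightarrow> (\<And>r. r \<ge> c + 1 \<Longrightarrow> s r = []) \<Longrightarrow>
         runs pc s ((total_length (map s ins) + 2) ^ kc) (s(c := CL (map s ins)))"
      using CL ins(1) by (rule polyfun_prog[of _ _ _ "c + 1" c]) (use ins in \<open>auto simp: c_def\<close>)
    have "set ins \<subseteq> {..<d}"
      using ins by (auto simp: d_def)
    from setup_prog[OF Fs ins(1) this] obtain pf Tf where pf: "poly_bounded Tf" "queries pf = {}"
      "\<And>s. (\<And>r. r \<ge> d \<Longrightarrow> s r = []) \<Longrightarrow> runs pf s (Tf (total_length (map s ins)))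
        (\<lambda>r. if d \<le> r \<and> r < d + length Fs then (Fs ! (r - d)) (map s ins) else s r)"
      by blast
    have queries_sim: "queries (clocked_prog qp c g d p) = {}"
      by (rule queries_clocked_prog) (use pq(1) K(1) in \<open>auto simp: qp_def\<close>)
    let ?end = "Seq (clear c) (clear_range d K)"
    let ?ret = "Seq (move d out D) (Push out True)"
    let ?p = "Seq pc (Seq pf (Seq (clocked_prog qp c g d p) (Seq (Case c Skip ?ret ?ret) ?end)))"
    let ?T = "\<lambda>n. (n + 2) ^ kc + (Tf n + (((Q n + overhead p) * (n + 2) ^ l + overhead p) +
      ((8 * S n + 4) + ((2 * (n + 2) ^ l + 1) + ((2 * S n + 1) * K + 1)))))"
    have "assigns ?p ins out base
      (\<lambda>ws. clocked (\<lambda>q w. ora q w ws) p (map (\<lambda>F. F ws) Fs) (length (CL ws))) ?T"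
      unfolding assigns_def
    proof (intro conjI allI impI)
      fix s :: state
      assume s: "s out = [] \<and> (\<forall>r\<ge>base. s r = [])"
      define ws where "ws = map s ins"
      define n where "n = total_length ws"
      have len: "length ws = m"
        using ins by (simp add: ws_def)
      define ora' where "ora' q w = ora q w ws" for q w
      define \<sigma> where "\<sigma> = initial (map (\<lambda>F. F ws) Fs)"
      interpret clocked_simulation ora' qp "queries p" c g d K "Z n" "Q n" "S n" s
        using s Z[OF len] by unfold_locales (auto simp: c_def g_def d_def ora'_def n_def)
      have map_encode: "map (encode \<tau> y) ins = ws" for \<tau> y
        unfolding ws_def encode_def using ins(2) by (auto simp: c_def d_def)
      have encode_out: "encode \<tau> y out = []" "encode \<tau> y D = []" "\<And>i. i \<ge> D \<Longrightarrow> encode \<tau> y i = []" for \<tau> y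
        unfolding encode_def using s ins(3) by (auto simp: c_def d_def D_def)
      have query: "runs (qp q r) (encode \<tau> y) (Q n) (encode (\<tau>(r := ora' q (\<tau> r))) y)"
        if q: "q \<in> queries p" and r: "r < K" and le: "length (\<tau> r) \<le> S n" for q r \<tau> y
      proof -
        let ?e = "encode \<tau> y" and ?a = "ora' q (\<tau> r)"
        have "runs (pq q r) ?e ((length (?e (d + r)) + total_length (map ?e ins) + 2) ^ kq q r)
            (?e(D := ora q (?e (d + r)) (map ?e ins)))"
          by (rule pq(2)[OF r]) (use encode_out in auto)
        then have 1: "runs (pq q r) ?e ((S n + n + 2) ^ kq q r) (?e(D := ?a))"
          by (rule runs_eq) (use r le in \<open>auto simp: map_encode ora'_def n_def intro!: power_mono\<close>)
        have 2: "runs (clear (d + r)) (?e(D := ?a)) (2 * S n + 1) (?e(D := ?a, d + r := []))"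
          by (rule runs_mono[OF runs_clear]) (use r le in \<open>auto simp: D_def\<close>)
        have "?e(D := []) = ?e"
          using encode_out(2)[of \<tau> y] by (simp only: fun_upd_idem_iff)
        moreover have "?e(D := ?a, d + r := [], D := [], d + r := ?a) = (?e(D := []))(d + r := ?a)"
          by (auto simp: fun_eq_iff simp del: encode_simps)
        ultimately have "?e(D := ?a, d + r := [], D := [], d + r := ?a) = encode (\<tau>(r := ?a)) y"
          using r by simp
        moreover have "runs (move D (d + r) (D + 1)) (?e(D := ?a, d + r := [])) (8 * Z n + 2)
            (?e(D := ?a, d + r := [], D := [], d + r := ?a))"
          by (rule runs_eq[OF runs_move]) (use r encode_out(3) Z(2) in \<open>auto simp: D_def\<close>)
        ultimately have 3: "runs (move D (d + r) (D + 1)) (?e(D := ?a, d + r := [])) (8 * Z n + 2) (encode (\<tau>(r := ?a)) y)"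
          by metis
        have "(S n + n + 2) ^ kq q r \<le> (\<Sum>r<K. (S n + n + 2) ^ kq q r)"
          using r by (intro member_le_sum) auto
        also have "\<dots> \<le> (\<Sum>q\<in>queries p. \<Sum>r<K. (S n + n + 2) ^ kq q r)"
          using q by (intro member_le_sum finite_queries) auto
        finally show ?thesis
          unfolding qp_def by (intro runs_mono[OF runs_Seq[OF 1 runs_Seq[OF 2 3]]]) (simp add: Q_def)
      qed
      have bound: "length (\<sigma> r) + Z n * length (CL ws) \<le> S n" for r
        unfolding \<sigma>_def n_def by (rule S[OF len])
      have "simulates p (clocked_prog qp c g d p) (overhead p) \<sigma> (CL ws)"
        by (rule simulates_clocked_prog) (use query K bound in auto)
      then obtain \<tau> y e where sim: "length (CL ws) = e + length y"
        "runs (clocked_prog qp c g d p) (encode \<sigma> (CL ws)) ((Q n + overhead p) * e + overhead p) (encode \<tau> y)"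
        "\<And>r. length (\<tau> r) \<le> length (\<sigma> r) + Z n * e"
        "y \<noteq> [] \<longrightarrow> exec ora' p \<sigma> e \<tau>"
        "\<And>t \<tau>. exec ora' p \<sigma> t \<tau> \<Longrightarrow> t < length (CL ws) \<Longrightarrow> y \<noteq> []"
        by (rule simulatesE) blast
      have \<tau>_le: "length (\<tau> r) \<le> S n" for r
        using sim(3)[of r] bound[of r] sim(1) by (simp add: algebra_simps)
      let ?out = "clocked ora' p (map (\<lambda>F. F ws) Fs) (length (CL ws))"
      have out: "?out = (if y = [] then [] else True # \<tau> 0)"
      proof (cases "y = []")
        case True
        have "\<not> halts_with ora' p (map (\<lambda>F. F ws) Fs) t out" if "t < length (CL ws)" for t out
          using sim(5) that True unfolding halts_with_def \<sigma>_def by blast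
        then show ?thesis
          using clocked_not_halts True by metis
      next
        case False
        then have "e < length (CL ws)" "halts_with ora' p (map (\<lambda>F. F ws) Fs) e (\<tau> 0)"
          using sim(1,4) unfolding halts_with_def \<sigma>_def by auto
        then show ?thesis
          using clocked_halts False by metis
      qed
      let ?s1 = "s(c := CL ws)"
      have 1: "runs pc s ((n + 2) ^ kc) ?s1"
        unfolding n_def ws_def by (rule pc(2)) (use s in \<open>auto simp: c_def\<close>)
      have "map ?s1 ins = ws"
        using ins(2) by (auto simp: ws_def c_def)
      moreover have "runs pf ?s1 (Tf (total_length (map ?s1 ins)))
          (\<lambda>r. if d \<le> r \<and> r < d + length Fs then (Fs ! (r - d)) (map ?s1 ins) else ?s1 r)"
        by (rule pf(3)) (use s in \<open>auto simp: c_def d_def\<close>)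
      moreover have "(\<lambda>r. if d \<le> r \<and> r < d + length Fs then (Fs ! (r - d)) ws else ?s1 r) = encode \<sigma> (CL ws)"
        unfolding encode_def using s K(2) by (auto simp: fun_eq_iff \<sigma>_def initial_def c_def d_def)
      ultimately have 2: "runs pf ?s1 (Tf n) (encode \<sigma> (CL ws))"
        by (simp only: n_def)
      have CL_le: "length (CL ws) \<le> (n + 2) ^ l"
        unfolding n_def by (rule l[OF len])
      with sim(1) have e_le: "e \<le> (n + 2) ^ l" and y_le: "length y \<le> (n + 2) ^ l"
        by auto
      have 3: "runs (clocked_prog qp c g d p) (encode \<sigma> (CL ws))
          ((Q n + overhead p) * (n + 2) ^ l + overhead p) (encode \<tau> y)"
        by (intro runs_mono[OF sim(2)] add_mono mult_le_mono e_le order.refl)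
      \<comment> \<open>Moving the output away empties simulated register 0, which happens only if
        the program has halted.\<close>
      define \<tau>' where "\<tau>' = (if y = [] then \<tau> else \<tau>(0 := []))"
      have 4: "runs (Case c Skip ?ret ?ret) (encode \<tau> y) (8 * S n + 4) ((encode \<tau>' y)(out := ?out))"
      proof (cases y)
        case Nil
        have "(encode \<tau>' y)(out := ?out) = encode \<tau> y"
          using Nil out encode_out(1)[of \<tau> y] by (auto simp: \<tau>'_def fun_eq_iff)
        then show ?thesis
          using Nil by (intro runs_eq[OF runs_Case_Nil[OF _ runs_Skip]]) auto
      next
        case (Cons v y1)
        have d: "encode \<tau> y d = \<tau> 0"
          using encode_simps(2)[of 0 \<tau> y] K(3) by simp
        have "(encode \<tau> y)(d := []) = encode \<tau>' y"
          using encode_simps(5)[of 0 \<tau> y "[]"] K(3) Cons by (simp add: \<tau>'_def)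
        moreover have "runs (move d out D) (encode \<tau> y) (8 * length (encode \<tau> y d) + 2)
            ((encode \<tau> y)(d := [], out := encode \<tau> y d))"
          by (rule runs_move) (use encode_out K(3) ins(3) in \<open>auto simp: d_def D_def\<close>)
        ultimately have "runs (move d out D) (encode \<tau> y) (8 * S n + 2) ((encode \<tau>' y)(out := \<tau> 0))"
          using \<tau>_le[of 0] d by (auto elim!: runs_mono)
        from runs_Seq[OF this runs_Push[of out True]]
        have "runs ?ret (encode \<tau> y) (8 * S n + 2 + 1) ((encode \<tau>' y)(out := ?out))"
          using out Cons by simp
        then have "runs (if v then ?ret else ?ret) (encode \<tau> y) (8 * S n + 3) ((encode \<tau>' y)(out := ?out))"
          by (auto elim: runs_mono)
        from runs_mono[OF runs_Case_Cons[of "encode \<tau> y" c v y1, OF _ this]] show ?thesis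
          using Cons by simp
      qed
      have 5: "runs (clear c) ((encode \<tau>' y)(out := ?out)) (2 * (n + 2) ^ l + 1) ((encode \<tau>' [])(out := ?out))"
        by (rule runs_eq[OF runs_clear]) (use ins(3) y_le in \<open>auto simp: fun_eq_iff c_def[symmetric] encode_def\<close>)
      have "runs (clear_range d K) ((encode \<tau>' [])(out := ?out)) ((2 * S n + 1) * K + 1)
          (\<lambda>r. if d \<le> r \<and> r < d + K then [] else ((encode \<tau>' [])(out := ?out)) r)"
      proof (rule runs_clear_range)
        fix r
        assume "r < K"
        moreover have "d + r \<noteq> out"
          using ins(3) by (simp add: d_def)
        ultimately show "length (((encode \<tau>' [])(out := ?out)) (d + r)) \<le> S n"
          using \<tau>_le[of r] by (simp add: \<tau>'_def)
      qed
      moreover have "(\<lambda>r. if d \<le> r \<and> r < d + K then [] else ((encode \<tau>' [])(out := ?out)) r) = s(out := ?out)"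
        unfolding encode_def using s ins(3) by (auto simp: fun_eq_iff c_def d_def)
      ultimately have 6: "runs (clear_range d K) ((encode \<tau>' [])(out := ?out)) ((2 * S n + 1) * K + 1) (s(out := ?out))"
        by simp
      show "runs ?p s (?T (total_length (map s ins)))
          (s(out := clocked (\<lambda>q w. ora q w (map s ins)) p (map (\<lambda>F. F (map s ins)) Fs) (length (CL (map s ins)))))"
        using runs_Seq[OF 1 runs_Seq[OF 2 runs_Seq[OF 3 runs_Seq[OF 4 runs_Seq[OF 5 6]]]]]
        unfolding n_def ws_def ora'_def .
    qed (use pf pc queries_sim in simp)
    moreover have "poly_bounded ?T"
      by (intro poly_bounded_intros poly_S poly_Q pf)
    ultimately show "\<exists>p' T. poly_bounded T \<and> assigns p' ins out base
        (\<lambda>ws. clocked (\<lambda>q w. ora q w ws) p (map (\<lambda>F. F ws) Fs) (length (CL ws))) T"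
      by blast
  qed
qed


section \<open>Functions on bit strings\<close>

lemma polypredI:
  "polyfun m F \<Longrightarrow> (\<And>ws. length ws = m \<Longrightarrow> F ws = (if P ws then [True] else [])) \<Longrightarrow> polypred m P"
  unfolding polypred_def by (rule polyfun_cong)

lemma polyfun_const_Cons: "polyfun m (\<lambda>_. [b])"
  by (rule polyfun_Cons[OF polyfun_Nil])

lemma polypred_const: "polypred m (\<lambda>_. b)"
  by (cases b) (auto intro: polypredI polyfun_Nil polyfun_const_Cons)

lemma polypred_not:
  assumes "polypred m P"
  shows "polypred m (\<lambda>ws. \<not> P ws)"
  by (rule polypredI[OF polyfun_if[OF assms polyfun_Nil polyfun_const_Cons[of m True]]]) auto

lemma polypred_conj:
  assumes "polypred m P" "polypred m P'"
  shows "polypred m (\<lambda>ws. P ws \<and> P' ws)"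
  by (rule polypredI[OF polyfun_if[OF assms(1) assms(2)[unfolded polypred_def] polyfun_Nil]]) auto

lemma polypred_imp:
  assumes "polypred m P" "polypred m P'"
  shows "polypred m (\<lambda>ws. P ws \<longrightarrow> P' ws)"
  by (rule polypredI[OF polyfun_if[OF assms(1) assms(2)[unfolded polypred_def] polyfun_const_Cons[of m True]]]) auto

lemma polypred_iff:
  assumes "polypred m P" "polypred m P'"
  shows "polypred m (\<lambda>ws. P ws \<longleftrightarrow> P' ws)"
  by (rule polypredI[OF polyfun_if[OF assms(1) assms(2)[unfolded polypred_def]
        polypred_not[OF assms(2), unfolded polypred_def]]]) auto

lemma polypred_let:
  assumes "polyfun m F" "polypred (Suc m) P"
  shows "polypred m (\<lambda>ws. P (F ws # ws))"
  using polyfun_let[OF assms(1) assms(2)[unfolded polypred_def]] unfolding polypred_def .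

lemma polyfun_Cons_pred:
  assumes "polypred m P" "polyfun m F"
  shows "polyfun m (\<lambda>ws. P ws # F ws)"
  by (rule polyfun_cong[OF polyfun_if[OF assms(1) polyfun_Cons[of _ _ True] polyfun_Cons[of _ _ False]]])
    (use assms(2) in auto)

lemmas polyfun_intros = polyfun_Nil polyfun_Cons polyfun_tl polyfun_if polyfun_hd polyfun_Cons_pred
  polypred_const polypred_not polypred_conj polypred_imp polypred_iff polypred_top_bit polypred_nonempty

text \<open>If the growth per step is bounded independently of the accumulator, then the total
  growth is at most the number of steps times a polynomial, which supplies the length bound for
  \<open>polyfun_fold\<close>.\<close>

lemma polyfun_fold_additive:
  assumes X: "polyfun m X" and A: "polyfun m A"
    and H: "\<And>b. polyfun (Suc m) (\<lambda>vs. H b (hd vs) (tl vs))"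
    and W: "polyfun m W"
    and le: "\<And>b a ws. length ws = m \<Longrightarrow> length (H b a ws) \<le> length a + (length (W ws) + z)"
  shows "polyfun m (\<lambda>ws. fold (\<lambda>b a. H b a ws) (X ws) (A ws))"
proof -
  from A obtain la where la: "\<And>ws. length ws = m \<Longrightarrow> length (A ws) \<le> (total_length ws + 2) ^ la"
    by (rule polyfun_length) blast
  from W obtain lw where lw: "\<And>ws. length ws = m \<Longrightarrow> length (W ws) \<le> (total_length ws + 2) ^ lw"
    by (rule polyfun_length) blast
  have "poly_bounded (\<lambda>n. (n + 2) ^ la + n * ((n + 2) ^ lw + z))"
    by (intro poly_bounded_intros)
  then obtain k where k: "\<And>n. (n + 2) ^ la + n * ((n + 2) ^ lw + z) \<le> (n + 2) ^ k"
    by (rule poly_boundedE) blast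
  show ?thesis
  proof (rule polyfun_fold[OF X A H])
    fix ws :: "bits list" and x :: bits
    assume len: "length ws = m"
    let ?n = "length x + total_length ws"
    have "length (fold (\<lambda>b a. H b a ws) x a) \<le> length a + length x * (length (W ws) + z)" for a
    proof (induction x arbitrary: a)
      case (Cons b x)
      show ?case
        using Cons.IH[of "H b a ws"] le[OF len, of b a] by simp
    qed simp
    then have "length (fold (\<lambda>b a. H b a ws) x (A ws)) \<le> length (A ws) + length x * (length (W ws) + z)" .
    also have "\<dots> \<le> (?n + 2) ^ la + ?n * ((?n + 2) ^ lw + z)"
    proof (intro add_mono mult_le_mono)
      show "length (A ws) \<le> (?n + 2) ^ la"
        by (rule le_trans[OF la[OF len]]) (simp add: power_mono)
      show "length (W ws) \<le> (?n + 2) ^ lw"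
        by (rule le_trans[OF lw[OF len]]) (simp add: power_mono)
    qed simp_all
    also have "\<dots> \<le> (?n + 2) ^ k"
      by (rule k)
    finally show "length (fold (\<lambda>b a. H b a ws) x (A ws)) \<le> (?n + 2) ^ k" .
  qed
qed

lemmas polyfun_fold_const = polyfun_fold_additive[OF _ _ _ polyfun_Nil]

lemma polyfun_rev:
  assumes "polyfun m X"
  shows "polyfun m (\<lambda>ws. rev (X ws))"
  unfolding rev_conv_fold
  by (rule polyfun_fold_const[where z = 1 and H = "\<lambda>b a _. b # a"])
    (auto intro: assms polyfun_intros)

lemma polyfun_append:
  assumes "polyfun m X" "polyfun m Y"
  shows "polyfun m (\<lambda>ws. X ws @ Y ws)"
proof -
  have *: "x @ y = fold (#) (rev x) y" for x y :: bits
    unfolding foldr_conv_fold[symmetric] by (induction x) auto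
  show ?thesis
    unfolding *
    by (rule polyfun_fold_const[where z = 1 and H = "\<lambda>b a _. b # a"])
      (auto intro: assms polyfun_rev polyfun_intros)
qed

lemma polyfun_drop:
  assumes "polyfun m X" "polyfun m Y"
  shows "polyfun m (\<lambda>ws. drop (length (X ws)) (Y ws))"
proof -
  have *: "drop (length x) y = fold (\<lambda>_. tl) x y" for x y :: bits
    by (induction x arbitrary: y) (auto simp: drop_Suc)
  show ?thesis
    unfolding *
    by (rule polyfun_fold_const[where z = 0 and H = "\<lambda>b a _. tl a"])
      (auto intro: assms polyfun_intros)
qed

text \<open>Multiplication of unary numbers: the length of the result is what counts. It supplies
  loop counters and, through \<open>pow\<close>, the clock.\<close>

definition times :: "bits \<Rightarrow> bits \<Rightarrow> bits" where
  "times x y = fold (\<lambda>_ a. x @ a) y []"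

lemma length_times [simp]: "length (times x y) = length x * length y"
proof -
  have "length (fold (\<lambda>_ a. x @ a) y z) = length x * length y + length z" for z
    by (induction y arbitrary: z) auto
  then show ?thesis
    by (simp add: times_def)
qed

lemma polyfun_times:
  assumes "polyfun m X" "polyfun m Y"
  shows "polyfun m (\<lambda>ws. times (X ws) (Y ws))"
  unfolding times_def
  by (rule polyfun_fold_additive[where z = 0 and W = X and H = "\<lambda>b a ws. X ws @ a"])
    (auto intro: assms polyfun_append polyfun_weaken[OF assms(1)] polyfun_intros)

primrec pow :: "nat \<Rightarrow> bits \<Rightarrow> bits" where
  "pow 0 x = [True]"
| "pow (Suc k) x = times x (pow k x)"

lemma length_pow [simp]: "length (pow k x) = length x ^ k"
  by (induction k) auto

lemma polyfun_pow: "polyfun m X \<Longrightarrow> polyfun m (\<lambda>ws. pow k (X ws))"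
  by (induction k) (auto intro: polyfun_times polyfun_const_Cons)

subsection \<open>Table lookup\<close>

text \<open>The head of the accumulator is a parity bit, and the tail gains one bit at every second
  step; the final \<open>tl\<close> discards the parity.\<close>

definition half :: "bits \<Rightarrow> bits" where
  "half x = tl (fold (\<lambda>_ a. if top_bit a then False # True # tl a else True # tl a) x [False])"

lemma length_half: "length (half x) = length x div 2"
proof -
  have "length (tl (fold (\<lambda>_ a. if top_bit a then False # True # tl a else True # tl a) x (b # y))) =
      length y + (length x + of_bool b) div 2" for b y
    by (induction x arbitrary: b y) auto
  then show ?thesis
    by (simp add: half_def)
qed

lemma polyfun_half:
  assumes "polyfun m X"
  shows "polyfun m (\<lambda>ws. half (X ws))"
  unfolding half_def
  by (intro polyfun_tl polyfun_fold_const[where z = 2 and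
        H = "\<lambda>_ a _. if top_bit a then False # True # tl a else True # tl a"])
    (auto intro!: assms polyfun_intros)

text \<open>With the order of \<open>inputs\<close>, the two halves of a table belong to the leading
  bits 0 and 1. The first half is obtained by dropping from the reversed string.\<close>

definition select :: "bool \<Rightarrow> bits \<Rightarrow> bits" where
  "select b x = (if b then drop (length (half x)) x else rev (drop (length (half x)) (rev x)))"

lemma select_append: "length x = length y \<Longrightarrow> select b (x @ y) = (if b then y else x)"
  by (simp add: select_def length_half)

lemma length_select_le: "length (select b x) \<le> length x"
  by (simp add: select_def)

lemma polyfun_select:
  assumes "polyfun m X"
  shows "polyfun m (\<lambda>ws. select b (X ws))"
  unfolding select_def
  by (intro polyfun_if polypred_const polyfun_drop polyfun_rev polyfun_half assms)

definition lookup :: "bits \<Rightarrow> bits \<Rightarrow> bits" where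
  "lookup x t = fold select x t"

lemma length_inputs: "length (inputs n) = 2 ^ n"
  by (induction n) auto

lemma length_truth_table [simp]: "length (truth_table n f) = 2 ^ n"
  by (simp add: truth_table_def length_inputs)

lemma truth_table_Suc:
  "truth_table (Suc n) f = truth_table n (\<lambda>x. f (False # x)) @ truth_table n (\<lambda>x. f (True # x))"
  by (simp add: truth_table_def comp_def)

text \<open>Each bit read fixes the leading variable and leaves the table of the restricted
  function, of half the length.\<close>

lemma lookup_truth_table:
  "lookup x (truth_table (length x + n) f) = truth_table n (\<lambda>y. f (x @ y))"
  unfolding lookup_def
  by (induction x arbitrary: f) (auto simp: truth_table_Suc select_append)

lemma top_bit_lookup: "length x = n \<Longrightarrow> top_bit (lookup x (truth_table n f)) = f x"
  using lookup_truth_table[of x 0 f] by (auto simp: truth_table_def)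

lemma polyfun_lookup:
  assumes "polyfun m X" "polyfun m T"
  shows "polyfun m (\<lambda>ws. lookup (X ws) (T ws))"
  unfolding lookup_def
  by (rule polyfun_fold_const[where z = 0 and H = "\<lambda>b a _. select b a"])
    (auto intro: assms polyfun_intros polyfun_select length_select_le)

text \<open>The arity is not part of the input but is needed by the learner. It is found by
  descending along \<open>True\<close> bits while the subtable has more than one entry;
  \<open>t\<close> itself is a long enough loop counter since \<open>n < 2 ^ n\<close>.\<close>

definition unary_log :: "bits \<Rightarrow> bits" where
  "unary_log t = fold (\<lambda>_ a. if tl (lookup a t) \<noteq> [] then True # a else a) t []"

lemma unary_log_truth_table: "unary_log (truth_table n f) = replicate n True"
proof -
  let ?t = "truth_table n f"
  have len: "length (lookup (replicate i True) ?t) = 2 ^ (n - i)" if "i \<le> n" for i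
    using lookup_truth_table[of "replicate i True" "n - i" f] that by simp
  have step: "tl (lookup (replicate i True) ?t) \<noteq> [] \<longleftrightarrow> i < n" if "i \<le> n" for i
  proof -
    have "tl (lookup (replicate i True) ?t) \<noteq> [] \<longleftrightarrow> 1 < length (lookup (replicate i True) ?t)"
      by (cases "lookup (replicate i True) ?t") auto
    then show ?thesis
      using len[OF that] one_less_power[of "2 :: nat" "n - i"] by (cases "i < n") auto
  qed
  \<comment> \<open>The counter rises by one in each iteration until it reaches \<open>n\<close>,
    and stays there.\<close>
  have "fold (\<lambda>_ a. if tl (lookup a ?t) \<noteq> [] then True # a else a) y (replicate i True) =
      replicate (min n (i + length y)) True" if "i \<le> n" for y :: bits and i
    using that
  proof (induction y arbitrary: i)
    case (Cons b y)
    show ?case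
    proof (cases "i < n")
      case True
      then show ?thesis
        using Cons.IH[of "Suc i"] step[of i] by simp
    next
      case False
      then show ?thesis
        using Cons.IH[of i] Cons.prems step[of i] by simp
    qed
  qed simp
  from this[of 0 ?t] show ?thesis
    using less_exp[of n] by (simp add: unary_log_def min_def)
qed

lemma polyfun_unary_log:
  assumes "polyfun m T"
  shows "polyfun m (\<lambda>ws. unary_log (T ws))"
  unfolding unary_log_def
  by (rule polyfun_fold_const[where z = 1 and H = "\<lambda>_ a ws. if tl (lookup a (T ws)) \<noteq> [] then True # a else a"])
    (auto intro!: assms polyfun_weaken[OF assms] polyfun_intros polyfun_lookup)

subsection \<open>Exhaustive search\<close>

text \<open>The least significant bit comes first and the last carry is lost, so the string of all
  ones wraps around and a search may begin anywhere.\<close>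

fun add_carry :: "bool \<Rightarrow> bits \<Rightarrow> bits" where
  "add_carry c [] = []"
| "add_carry c (b # x) = (b \<noteq> c) # add_carry (b \<and> c) x"

abbreviation increment :: "bits \<Rightarrow> bits" where
  "increment \<equiv> add_carry True"

lemma length_add_carry [simp]: "length (add_carry c x) = length x"
  by (induction x arbitrary: c) auto

lemma polyfun_increment:
  assumes "polyfun m X"
  shows "polyfun m (\<lambda>ws. increment (X ws))"
proof -
  \<comment> \<open>The head of the accumulator is the carry; behind it stand the result bits so
    far, in reverse order.\<close>
  let ?h = "\<lambda>b a. (b \<and> top_bit a) # (b \<noteq> top_bit a) # tl a"
  have "rev (tl (fold ?h x (c # y))) = rev y @ add_carry c x" for x c y
    by (induction x arbitrary: c y) auto
  then have *: "increment x = rev (tl (fold ?h x [True]))" for x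
    by simp
  show ?thesis
    unfolding *
    by (intro polyfun_rev polyfun_tl polyfun_fold_const[where z = 2 and H = "\<lambda>b a _. ?h b a"])
      (auto intro!: assms polyfun_intros)
qed

primrec bits_val :: "bits \<Rightarrow> nat" where
  "bits_val [] = 0"
| "bits_val (b # x) = of_bool b + 2 * bits_val x"

lemma bits_val_less: "bits_val x < 2 ^ length x"
  by (induction x) auto

lemma bits_val_inj: "length x = length y \<Longrightarrow> bits_val x = bits_val y \<Longrightarrow> x = y"
proof (induction x arbitrary: y)
  case (Cons b x)
  then obtain c z where y: "y = c # z"
    by (cases y) auto
  with Cons.prems have eq: "of_bool b + 2 * bits_val x = of_bool c + 2 * bits_val z"
    by simp
  then have "b = c"
    by (cases b; cases c; simp; presburger)
  with eq Cons y show ?case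
    by auto
qed simp

lemma bits_val_add_carry: "bits_val (add_carry c x) = (bits_val x + of_bool c) mod 2 ^ length x"
proof (induction x arbitrary: c)
  case (Cons b x)
  show ?case
  proof (cases "b \<and> c")
    case True
    then show ?thesis
      using Cons.IH[of True] by (simp add: mult_mod_right)
  next
    case False
    have "bits_val (add_carry False x) = bits_val x"
      using Cons.IH[of False] bits_val_less[of x] by simp
    moreover have "of_bool b + 2 * bits_val x + of_bool c < 2 * 2 ^ length x"
      using False bits_val_less[of x] by (cases b; cases c; simp)
    ultimately show ?thesis
      using False by (cases b; cases c; simp)
  qed
qed simp

lemma length_funpow_increment [simp]: "length ((increment ^^ j) x) = length x"
  by (induction j) auto

lemma increment_cycle:
  assumes "length x = length u"
  shows "\<exists>j < 2 ^ length u. (increment ^^ j) u = x"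
proof -
  let ?N = "2 ^ length u :: nat"
  have val: "bits_val ((increment ^^ j) u) = (bits_val u + j) mod ?N" for j
  proof (induction j)
    case 0
    show ?case
      using bits_val_less[of u] by simp
  next
    case (Suc j)
    then show ?case
      by (simp add: bits_val_add_carry mod_simps)
  qed
  \<comment> \<open>The distance from \<open>u\<close> to \<open>x\<close> modulo \<open>?N\<close>;
    adding \<open>?N\<close> keeps the subtraction of naturals from truncating.\<close>
  define j where "j = (bits_val x + ?N - bits_val u) mod ?N"
  have "bits_val ((increment ^^ j) u) = (bits_val u + (bits_val x + ?N - bits_val u)) mod ?N"
    unfolding val j_def by (simp add: mod_simps)
  also have "\<dots> = bits_val x"
    using bits_val_less[of u] bits_val_less[of x] assms by simp
  finally have "(increment ^^ j) u = x"
    by (intro bits_val_inj) (use assms in auto)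
  moreover have "j < ?N"
    by (simp add: j_def)
  ultimately show ?thesis
    by blast
qed

text \<open>
  Incrementing a string runs through all strings of its length cyclically, so \<open>search\<close> ends in a
  string satisfying \<open>P\<close> if there is one and the loop is long enough.
\<close>

definition search :: "(bits \<Rightarrow> bool) \<Rightarrow> bits \<Rightarrow> bits \<Rightarrow> bits" where
  "search P u i = fold (\<lambda>_ x. if P x then x else increment x) i u"

lemma length_search [simp]: "length (search P u i) = length u"
  unfolding search_def by (induction i arbitrary: u) auto

lemma search_exists:
  assumes "2 ^ length u \<le> length i"
  shows "P (search P u i) \<longleftrightarrow> (\<exists>x. length x = length u \<and> P x)"
proof
  assume "\<exists>x. length x = length u \<and> P x"
  then obtain j where j: "j < 2 ^ length u" "P ((increment ^^ j) u)"
    using increment_cycle by metis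
  have stay: "search P u i = u" if "P u" for u i
    using that unfolding search_def by (induction i) auto
  \<comment> \<open>The search may meet an earlier hit before \<open>j\<close> increments are made;
    by \<open>stay\<close> it then remains there.\<close>
  have "P (search P u i)" if "P ((increment ^^ j) u)" "j \<le> length i" for j
    using that
  proof (induction i arbitrary: j u)
    case Nil
    then show ?case
      by (simp add: search_def)
  next
    case (Cons b i)
    show ?case
    proof (cases "P u")
      case True
      then show ?thesis
        by (simp add: stay)
    next
      case False
      with Cons.prems obtain j' where "j = Suc j'"
        by (cases j) auto
      with Cons.prems Cons.IH[of j' "increment u"] False show ?thesis
        by (simp add: search_def funpow_swap1)
    qed
  qed
  with j assms show "P (search P u i)"
    by auto
qed (metis length_search)

lemma polyfun_search:
  assumes P: "polypred (Suc m) (\<lambda>vs. P (hd vs) (tl vs))" and "polyfun m U" "polyfun m I"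
  shows "polyfun m (\<lambda>ws. search (\<lambda>x. P x ws) (U ws) (I ws))"
  unfolding search_def
  by (rule polyfun_fold_const[where z = 0 and H = "\<lambda>_ x ws. if P x ws then x else increment x"])
    (auto intro!: assms polyfun_intros polyfun_increment)

lemma polypred_search:
  assumes "polypred (Suc m) (\<lambda>vs. P (hd vs) (tl vs))" "polyfun m U" "polyfun m I"
  shows "polypred m (\<lambda>ws. P (search (\<lambda>x. P x ws) (U ws) (I ws)) ws)"
  using polypred_let[OF polyfun_search[OF assms] assms(1)] by simp


section \<open>Relevant possibility queries\<close>

text \<open>The head of the accumulator is the verdict so far. The next two bits are the flags of
  the positive and the negative literal of the current variable; they are consumed.\<close>

definition agree_step :: "bool \<Rightarrow> bits \<Rightarrow> bits" where
  "agree_step b a = (top_bit a \<and> (top_bit (tl a) \<longrightarrow> b) \<and> (top_bit (tl (tl a)) \<longrightarrow> \<not> b)) # tl (tl (tl a))"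

definition agrees :: "bits \<Rightarrow> bits \<Rightarrow> bool" where
  "agrees x y \<longleftrightarrow> top_bit (fold agree_step x (True # y))"

lemma agrees_iff:
  assumes "length y = 2 * length x"
  shows "agrees x y \<longleftrightarrow> (\<forall>(i, b) \<in> literals_of (length x) y. x ! i = b)"
proof -
  have "top_bit (fold agree_step x (c # y)) \<longleftrightarrow>
      c \<and> (\<forall>i<length x. (y ! (2 * i) \<longrightarrow> x ! i) \<and> (y ! (2 * i + 1) \<longrightarrow> \<not> x ! i))" for c
    using assms
  proof (induction x arbitrary: c y)
    case (Cons b x)
    then obtain p q z where "y = p # q # z" "length z = 2 * length x"
      by (auto simp: length_Suc_conv)
    with Cons.IH[of z] show ?case
      by (simp add: agree_step_def All_less_Suc2 del: All_less_Suc)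
  qed simp
  then show ?thesis
    by (auto simp: agrees_def literals_of_def split: if_splits)
qed

lemma polypred_agrees:
  assumes "polyfun m X" "polyfun m Y"
  shows "polypred m (\<lambda>ws. agrees (X ws) (Y ws))"
  unfolding agrees_def
  by (intro polypred_top_bit polyfun_fold_const[where z = 1 and H = "\<lambda>b a _. agree_step b a"])
    (auto simp: agree_step_def intro!: assms polyfun_intros)

definition subset_step :: "bool \<Rightarrow> bits \<Rightarrow> bits" where
  "subset_step b a = (top_bit a \<and> (b \<longrightarrow> top_bit (tl a))) # tl (tl a)"

definition bits_subset :: "bits \<Rightarrow> bits \<Rightarrow> bool" where
  "bits_subset x y \<longleftrightarrow> top_bit (fold subset_step x (True # y))"

lemma bits_subset_iff:
  assumes "length x = length y"
  shows "bits_subset x y \<longleftrightarrow> (\<forall>i<length x. x ! i \<longrightarrow> y ! i)"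
proof -
  have "top_bit (fold subset_step x (c # y)) \<longleftrightarrow> c \<and> (\<forall>i<length x. x ! i \<longrightarrow> y ! i)" for c
    using assms
  proof (induction x arbitrary: c y)
    case (Cons b x)
    then obtain q z where "y = q # z" "length x = length z"
      by (cases y) auto
    with Cons.IH[of z] show ?case
      by (simp add: subset_step_def All_less_Suc2 del: All_less_Suc)
  qed simp
  then show ?thesis
    by (simp add: bits_subset_def)
qed

lemma literals_of_subset_iff:
  assumes "length x = 2 * n" "length y = 2 * n"
  shows "literals_of n x \<subseteq> literals_of n y \<longleftrightarrow> (\<forall>i<2 * n. x ! i \<longrightarrow> y ! i)"
proof
  assume sub: "literals_of n x \<subseteq> literals_of n y"
  show "\<forall>i<2 * n. x ! i \<longrightarrow> y ! i"
  proof (intro allI impI)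
    fix i
    assume i: "i < 2 * n" "x ! i"
    \<comment> \<open>Position \<open>i\<close> stands for the literal
      \<open>(i div 2, even i)\<close>.\<close>
    have idx: "2 * (i div 2) + (if even i then 0 else 1) = i"
      by (simp add: odd_two_times_div_two_succ)
    then have "(i div 2, even i) \<in> literals_of n x"
      using i by (auto simp: literals_of_def)
    with sub have "(i div 2, even i) \<in> literals_of n y"
      by blast
    with idx show "y ! i"
      by (simp add: literals_of_def)
  qed
qed (auto simp: literals_of_def)

lemma bits_subset_literals_of:
  "length x = 2 * n \<Longrightarrow> length y = 2 * n \<Longrightarrow> bits_subset x y \<longleftrightarrow> literals_of n x \<subseteq> literals_of n y"
  by (simp add: bits_subset_iff literals_of_subset_iff)

lemma literals_of_surj:
  assumes "M \<subseteq> {..<n} \<times> UNIV"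
  shows "\<exists>y. length y = 2 * n \<and> literals_of n y = M"
proof -
  have "literals_of n (map (\<lambda>j. (j div 2, even j) \<in> M) [0..<2 * n]) = M"
  proof (intro set_eqI, clarify)
    fix i b
    show "(i, b) \<in> literals_of n (map (\<lambda>j. (j div 2, even j) \<in> M) [0..<2 * n]) \<longleftrightarrow> (i, b) \<in> M"
      using assms by (cases b) (auto simp: literals_of_def)
  qed
  then show ?thesis
    by (intro exI[of _ "map (\<lambda>j. (j div 2, even j) \<in> M) [0..<2 * n]"]) simp
qed

text \<open>An implicant mentions only variables below \<open>n\<close>, so every relevant set of
  literals is represented by some string and a search through strings misses none.\<close>

lemma ex_literals_of:
  assumes "\<And>M. P M \<Longrightarrow> implicant n f M"
  shows "(\<exists>y. length y = 2 * n \<and> P (literals_of n y)) \<longleftrightarrow> (\<exists>M. P M)"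
proof
  assume "\<exists>M. P M"
  then obtain M where M: "P M"
    by blast
  then have "M \<subseteq> {..<n} \<times> UNIV"
    using assms unfolding implicant_def by blast
  from literals_of_surj[OF this] M show "\<exists>y. length y = 2 * n \<and> P (literals_of n y)"
    by blast
qed blast

lemma polypred_bits_subset:
  assumes "polyfun m X" "polyfun m Y"
  shows "polypred m (\<lambda>ws. bits_subset (X ws) (Y ws))"
  unfolding bits_subset_def
  by (intro polypred_top_bit polyfun_fold_const[where z = 1 and H = "\<lambda>b a _. subset_step b a"])
    (auto simp: subset_step_def intro!: assms polyfun_intros)

text \<open>
  Below, \<open>t\<close> is a truth table on \<open>n\<close> variables and \<open>u\<close> is \<open>n\<close> in unary, so that the searches over
  inputs and over literal sets take \<open>2 ^ n\<close> and \<open>4 ^ n\<close> steps, the lengths of \<open>t\<close> and \<open>times t t\<close>.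
\<close>

definition exists_string :: "(bits \<Rightarrow> bool) \<Rightarrow> bits \<Rightarrow> bits \<Rightarrow> bool" where
  "exists_string P u i \<longleftrightarrow> P (search P u i)"

lemma polypred_exists_string:
  assumes "polypred (Suc m) (\<lambda>vs. P (hd vs) (tl vs))" "polyfun m U" "polyfun m I"
  shows "polypred m (\<lambda>ws. exists_string (\<lambda>x. P x ws) (U ws) (I ws))"
  unfolding exists_string_def by (rule polypred_search[OF assms])

lemma exists_string_iff:
  "2 ^ length u \<le> length i \<Longrightarrow> exists_string P u i \<longleftrightarrow> (\<exists>x. length x = length u \<and> P x)"
  unfolding exists_string_def by (rule search_exists)

text \<open>Consistency is tested semantically: some input agrees with a set of literals exactly if
  no variable occurs in it with both signs.\<close>

definition table_implicant :: "bits \<Rightarrow> bits \<Rightarrow> bits \<Rightarrow> bool" where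
  "table_implicant t u y \<longleftrightarrow> exists_string (\<lambda>x. agrees x y) u t \<and>
     \<not> exists_string (\<lambda>x. agrees x y \<and> \<not> top_bit (lookup x t)) u t"

lemma polypred_table_implicant:
  assumes "polyfun m T" "polyfun m U" "polyfun m Y"
  shows "polypred m (\<lambda>ws. table_implicant (T ws) (U ws) (Y ws))"
  unfolding table_implicant_def
  by (intro polypred_conj polypred_not polypred_exists_string assms polypred_agrees polyfun_hd
      polypred_top_bit polyfun_lookup polyfun_weaken[OF assms(1)] polyfun_weaken[OF assms(3)])

lemma table_implicant_iff:
  assumes "length u = n" "length y = 2 * n"
  shows "table_implicant (truth_table n f) u y \<longleftrightarrow> implicant n f (literals_of n y)"
proof -
  let ?M = "literals_of n y"
  have agr: "agrees x y \<longleftrightarrow> (\<forall>(i, b) \<in> ?M. x ! i = b)" if "length x = n" for x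
    using agrees_iff[of y x] that assms by simp
  have "exists_string (\<lambda>x. agrees x y) u (truth_table n f) \<longleftrightarrow> (\<exists>x. length x = n \<and> (\<forall>(i, b) \<in> ?M. x ! i = b))"
    using exists_string_iff[of u "truth_table n f"] assms(1) agr by auto
  also have "\<dots> \<longleftrightarrow> (\<nexists>i. (i, True) \<in> ?M \<and> (i, False) \<in> ?M)"
  proof
    assume "\<nexists>i. (i, True) \<in> ?M \<and> (i, False) \<in> ?M"
    \<comment> \<open>Making exactly the positive literals true satisfies a consistent set;
      variables that do not occur become \<open>False\<close>.\<close>
    then have "\<forall>(i, b) \<in> ?M. map (\<lambda>i. (i, True) \<in> ?M) [0..<n] ! i = b"
      by (auto simp: literals_of_def)
    then show "\<exists>x. length x = n \<and> (\<forall>(i, b) \<in> ?M. x ! i = b)"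
      by (intro exI[of _ "map (\<lambda>i. (i, True) \<in> ?M) [0..<n]"]) simp
  next
    assume "\<exists>x. length x = n \<and> (\<forall>(i, b) \<in> ?M. x ! i = b)"
    then obtain x where "\<And>i b. (i, b) \<in> ?M \<Longrightarrow> x ! i = b"
      by auto
    from this[of _ True] this[of _ False] show "\<nexists>i. (i, True) \<in> ?M \<and> (i, False) \<in> ?M"
      by blast
  qed
  finally have 1: "exists_string (\<lambda>x. agrees x y) u (truth_table n f) \<longleftrightarrow>
      (\<nexists>i. (i, True) \<in> ?M \<and> (i, False) \<in> ?M)" .
  have 2: "exists_string (\<lambda>x. agrees x y \<and> \<not> top_bit (lookup x (truth_table n f))) u (truth_table n f) \<longleftrightarrow>
      (\<exists>x. length x = n \<and> (\<forall>(i, b) \<in> ?M. x ! i = b) \<and> \<not> f x)"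
    using exists_string_iff[of u "truth_table n f"] assms(1) agr top_bit_lookup by auto
  have "?M \<subseteq> {..<n} \<times> UNIV"
    by (auto simp: literals_of_def)
  then show ?thesis
    unfolding table_implicant_def implicant_def 1 2 by blast
qed

definition relevant_possibility :: "bits \<Rightarrow> bits \<Rightarrow> bits \<Rightarrow> bool" where
  "relevant_possibility t u w \<longleftrightarrow> exists_string (\<lambda>y. bits_subset w y \<and> table_implicant t u y \<and>
     \<not> exists_string (\<lambda>z. (bits_subset z y \<and> \<not> bits_subset y z) \<and> table_implicant t u z)
         (u @ u) (times t t)) (u @ u) (times t t)"

lemma polypred_relevant_possibility:
  assumes T: "polyfun m T" and U: "polyfun m U" and W: "polyfun m W"
  shows "polypred m (\<lambda>ws. relevant_possibility (T ws) (U ws) (W ws))"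
proof -
  \<comment> \<open>The nested searches bind two variables in front of the arguments: functions with
    two primes are used under both binders, and \<open>hd'\<close> is the outer candidate seen from
    the inner search.\<close>
  note T' = polyfun_weaken[OF T] and U' = polyfun_weaken[OF U] and W' = polyfun_weaken[OF W]
  note T'' = polyfun_weaken[OF T'] and U'' = polyfun_weaken[OF U']
  note hd' = polyfun_weaken[OF polyfun_hd]
  show ?thesis
    unfolding relevant_possibility_def
    by (intro polypred_exists_string polypred_conj polypred_not polypred_bits_subset
        polypred_table_implicant polyfun_append polyfun_times T U T' U' W' T'' U'' polyfun_hd hd')
qed

lemma relevant_possibility_iff:
  assumes u: "length u = n" and w: "length w = 2 * n"
  shows "relevant_possibility (truth_table n f) u w \<longleftrightarrow> (\<exists>M. minterm n f M \<and> literals_of n w \<subseteq> M)"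
proof -
  let ?t = "truth_table n f"
  let ?strict = "\<lambda>z y. (bits_subset z y \<and> \<not> bits_subset y z) \<and> table_implicant ?t u z"
  have ex: "exists_string P (u @ u) (times ?t ?t) \<longleftrightarrow> (\<exists>y. length y = 2 * n \<and> P y)" for P
    by (subst exists_string_iff) (simp_all add: u power_add mult_2)
  have strict: "exists_string (\<lambda>z. ?strict z y) (u @ u) (times ?t ?t) \<longleftrightarrow>
      (\<exists>M'. M' \<subset> literals_of n y \<and> implicant n f M')" if y: "length y = 2 * n" for y
  proof -
    have "?strict z y \<longleftrightarrow> literals_of n z \<subset> literals_of n y \<and> implicant n f (literals_of n z)"
      if "length z = 2 * n" for z
      using that y u by (auto simp: bits_subset_literals_of table_implicant_iff)
    then have "exists_string (\<lambda>z. ?strict z y) (u @ u) (times ?t ?t) \<longleftrightarrow>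
        (\<exists>z. length z = 2 * n \<and> literals_of n z \<subset> literals_of n y \<and> implicant n f (literals_of n z))"
      unfolding ex by blast
    also have "\<dots> \<longleftrightarrow> (\<exists>M'. M' \<subset> literals_of n y \<and> implicant n f M')"
      by (rule ex_literals_of) blast
    finally show ?thesis .
  qed
  have "relevant_possibility ?t u w \<longleftrightarrow> (\<exists>y. length y = 2 * n \<and>
      minterm n f (literals_of n y) \<and> literals_of n w \<subseteq> literals_of n y)"
    unfolding relevant_possibility_def
  proof (subst ex, rule ex_cong1, rule conj_cong[OF refl])
    fix y :: bits
    assume y: "length y = 2 * n"
    have "bits_subset w y \<longleftrightarrow> literals_of n w \<subseteq> literals_of n y"
      "table_implicant ?t u y \<longleftrightarrow> implicant n f (literals_of n y)"
      using y u w by (simp_all add: bits_subset_literals_of table_implicant_iff)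
    then show "bits_subset w y \<and> table_implicant ?t u y \<and>
        \<not> exists_string (\<lambda>z. ?strict z y) (u @ u) (times ?t ?t) \<longleftrightarrow>
        minterm n f (literals_of n y) \<and> literals_of n w \<subseteq> literals_of n y"
      unfolding strict[OF y] minterm_def by blast
  qed
  also have "\<dots> \<longleftrightarrow> (\<exists>M. minterm n f M \<and> literals_of n w \<subseteq> M)"
    by (rule ex_literals_of[of _ n f]) (simp add: minterm_def)
  finally show ?thesis .
qed

section \<open>The truth-table minimizer\<close>

lemma polyfun_clocked_no_oracle:
  fixes p :: "unit prog"
  assumes CL: "polyfun m CL" and Fs: "\<And>F. F \<in> set Fs \<Longrightarrow> polyfun m F"
  shows "polyfun m (\<lambda>ws. clocked (\<lambda>_ _. []) p (map (\<lambda>F. F ws) Fs) (length (CL ws)))"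
  by (rule polyfun_clocked[OF CL Fs, where z = 0]) (auto intro: polyfun_Nil)

text \<open>The \<open>tl\<close> strips the mark of a halted run, and a timeout counts as the value
  \<open>False\<close>. With a sufficient clock this can affect only strings that are not models of
  the right arity.\<close>

definition disagrees :: "unit prog \<Rightarrow> bits \<Rightarrow> bits \<Rightarrow> bits \<Rightarrow> bits \<Rightarrow> bool" where
  "disagrees E t c h x \<longleftrightarrow>
     \<not> (top_bit (tl (clocked (\<lambda>_ _. []) E [h, x] (length c))) \<longleftrightarrow> top_bit (lookup x t))"

lemma polypred_disagrees:
  assumes "polyfun m T" "polyfun m CL" "polyfun m H" "polyfun m X"
  shows "polypred m (\<lambda>ws. disagrees E (T ws) (CL ws) (H ws) (X ws))"
proof -
  have "polyfun m F" if "F \<in> set [H, X]" for F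
    using that assms(3,4) by auto
  from polyfun_clocked_no_oracle[OF assms(2) this, of "[H, X]" E]
  have "polyfun m (\<lambda>ws. clocked (\<lambda>_ _. []) E [H ws, X ws] (length (CL ws)))"
    by simp
  then show ?thesis
    unfolding disagrees_def
    by (intro polypred_not polypred_iff polypred_top_bit polyfun_tl polyfun_lookup assms)
qed

text \<open>Ill-formed queries are answered too, by whatever the computation yields, as
  \<open>oracle_for\<close> permits. The counterexample is the string where the search ends, hence a
  function of the hypothesis.\<close>

fun answer :: "unit prog \<Rightarrow> bits \<Rightarrow> bits \<Rightarrow> bits \<Rightarrow> query \<Rightarrow> bits \<Rightarrow> bits" where
  "answer E t u c Membership w = [top_bit (lookup w t)]"
| "answer E t u c Equivalence w = (if exists_string (disagrees E t c w) u t
     then False # search (disagrees E t c w) u t else [True])"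
| "answer E t u c Relevant_Possibility w = [relevant_possibility t u w]"

text \<open>The bound is independent of the query \<open>w\<close>, as the simulation by
  \<open>polyfun_clocked\<close> demands.\<close>

lemma length_answer: "length (answer E t u c q w) \<le> length u + 1"
  by (cases q) auto

lemma polyfun_answer:
  assumes T: "polyfun m T" and U: "polyfun m U" and CL: "polyfun m CL" and W: "polyfun m W"
  shows "polyfun m (\<lambda>ws. answer E (T ws) (U ws) (CL ws) q (W ws))"
proof (cases q)
  case Membership
  then show ?thesis
    by (simp, intro polyfun_Cons_pred polyfun_Nil polypred_top_bit polyfun_lookup W T)
next
  case Equivalence
  have "polypred (Suc m) (\<lambda>vs. disagrees E (T (tl vs)) (CL (tl vs)) (W (tl vs)) (hd vs))"
    by (intro polypred_disagrees polyfun_weaken[OF T] polyfun_weaken[OF CL] polyfun_weaken[OF W] polyfun_hd)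
  with Equivalence show ?thesis
    by (simp, intro polyfun_if polyfun_Cons polyfun_Nil U T
        polypred_exists_string[where P = "\<lambda>x ws. disagrees E (T ws) (CL ws) (W ws) x"]
        polyfun_search[where P = "\<lambda>x ws. disagrees E (T ws) (CL ws) (W ws) x"])
next
  case Relevant_Possibility
  then show ?thesis
    by (simp, intro polyfun_Cons_pred polyfun_Nil polypred_relevant_possibility W T U)
qed

lemma disagrees_iff:
  assumes E: "evaluator C E T" and "T n < length c"
    and h: "h \<in> models C" "nvars C h = n" and x: "length x = n"
  shows "disagrees E (truth_table n f) c h x \<longleftrightarrow> func C h x \<noteq> f x"
proof -
  have "computes_within E [h, x] (T n) [func C h x]"
    using E h x unfolding evaluator_def by blast
  then obtain t where t: "t \<le> T n" "halts_with (\<lambda>_ _. []) E [h, x] t [func C h x]"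
    unfolding computes_within_def by blast
  have "clocked (\<lambda>_ _. []) E [h, x] (length c) = [True, func C h x]"
    by (rule clocked_halts[OF t(2) le_less_trans[OF t(1) assms(2)]])
  then show ?thesis
    by (auto simp: disagrees_def top_bit_lookup[OF x])
qed

lemma exists_disagrees_iff:
  assumes "evaluator C E T" "T n < length c" "h \<in> models C" "nvars C h = n" "length u = n"
  shows "exists_string (disagrees E (truth_table n f) c h) u (truth_table n f) \<longleftrightarrow> \<not> computes C h n f"
proof -
  have "exists_string (disagrees E (truth_table n f) c h) u (truth_table n f) \<longleftrightarrow>
      (\<exists>x. length x = n \<and> disagrees E (truth_table n f) c h x)"
    using exists_string_iff[of u "truth_table n f"] assms(5) by simp
  also have "\<dots> \<longleftrightarrow> (\<exists>x. length x = n \<and> func C h x \<noteq> f x)"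
    by (rule ex_cong1, rule conj_cong[OF refl]) (rule disagrees_iff[OF assms(1-4)])
  finally show ?thesis
    using assms(4) by (simp add: computes_def)
qed

text \<open>The function \<open>f\<close> is arbitrary here, so that properness of the learner can
  be invoked for targets outside the class as well.\<close>

lemma oracle_for_answer:
  assumes E: "evaluator C E T" "T n < length c" and u: "length u = n"
  shows "oracle_for C n f (answer E (truth_table n f) u c)"
  unfolding oracle_for_def
proof (intro conjI allI impI ballI)
  fix h
  assume h: "h \<in> models C" "nvars C h = n"
  let ?t = "truth_table n f"
  let ?x = "search (disagrees E ?t c h) u ?t"
  show "if computes C h n f then answer E ?t u c Equivalence h = [True]
      else \<exists>x. length x = n \<and> func C h x \<noteq> f x \<and> answer E ?t u c Equivalence h = False # x"
  proof (cases "computes C h n f")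
    case True
    then show ?thesis
      using exists_disagrees_iff[OF E h u] by simp
  next
    case False
    then have ex: "exists_string (disagrees E ?t c h) u ?t"
      using exists_disagrees_iff[OF E h u] by simp
    then have "func C h ?x \<noteq> f ?x"
      using disagrees_iff[OF E h, of ?x f] u by (simp add: exists_string_def)
    with False ex u show ?thesis
      by simp
  qed
qed (use u in \<open>simp_all add: top_bit_lookup relevant_possibility_iff\<close>)

text \<open>One clock \<open>c\<close> serves all three programs, and each \<open>tl\<close> strips
  the mark of a halted run. The hypothesis is checked in any case, since exactness says nothing
  about targets outside the class.\<close>

definition minimize :: "query prog \<Rightarrow> unit prog \<Rightarrow> unit prog \<Rightarrow> bits \<Rightarrow> bits \<Rightarrow> bits \<Rightarrow> bits" where
  "minimize A E B t u c =
     (let r = clocked (answer E t u c) A [u] (length c) in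
      if r \<noteq> [] \<and> \<not> exists_string (disagrees E t c (tl r)) u t
      then True # tl (clocked (\<lambda>_ _. []) B [tl r] (length c)) else [False])"

lemma polyfun_minimize:
  assumes T: "polyfun m T" and U: "polyfun m U" and CL: "polyfun m CL"
  shows "polyfun m (\<lambda>ws. minimize A E B (T ws) (U ws) (CL ws))"
proof -
  have R: "polyfun m (\<lambda>ws. clocked (answer E (T ws) (U ws) (CL ws)) A [U ws] (length (CL ws)))"
  proof -
    from U obtain l where l: "\<And>ws. length ws = m \<Longrightarrow> length (U ws) \<le> (total_length ws + 2) ^ l"
      by (rule polyfun_length) blast
    have "length (answer E (T ws) (U ws) (CL ws) q w) \<le> (total_length ws + 2) ^ (l + 1)"
      if "length ws = m" for q w ws
    proof -
      have "length (answer E (T ws) (U ws) (CL ws) q w) \<le> (total_length ws + 2) ^ l + 1"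
        using length_answer[of E "T ws" "U ws" "CL ws" q w] l[OF that] by linarith
      also have "\<dots> \<le> (total_length ws + 2) ^ (l + 1)"
      proof -
        have "1 \<le> (total_length ws + 2) ^ l"
          by (rule one_le_power) simp
        moreover have "2 * (total_length ws + 2) ^ l \<le> (total_length ws + 2) * (total_length ws + 2) ^ l"
          by (rule mult_le_mono1) simp
        ultimately show ?thesis
          unfolding Suc_eq_plus1[symmetric] power_Suc by linarith
      qed
      finally show ?thesis .
    qed
    from polyfun_clocked[OF CL, of "[U]" "\<lambda>q w ws. answer E (T ws) (U ws) (CL ws) q w", OF _ _ this]
    show ?thesis
      using U polyfun_answer[OF polyfun_weaken[OF T] polyfun_weaken[OF U] polyfun_weaken[OF CL] polyfun_hd]
      by simp
  qed
  \<comment> \<open>The environment is an input, then the result of the learner, then the arguments: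
    \<open>hd vs\<close> is the input tested and \<open>tl (hd (tl vs))\<close> the
    hypothesis.\<close>
  have "polypred (Suc (Suc m)) (\<lambda>vs. disagrees E (T (tl (tl vs))) (CL (tl (tl vs))) (tl (hd (tl vs))) (hd vs))"
    by (intro polypred_disagrees polyfun_weaken[OF polyfun_weaken[OF T]] polyfun_tl
        polyfun_weaken[OF polyfun_weaken[OF CL]] polyfun_weaken[OF polyfun_hd] polyfun_hd)
  then have X: "polypred (Suc m) (\<lambda>vs. exists_string (disagrees E (T (tl vs)) (CL (tl vs)) (tl (hd vs))) (U (tl vs)) (T (tl vs)))"
    by (intro polyfun_weaken[OF T] polyfun_weaken[OF U]
        polypred_exists_string[where P = "\<lambda>x ws. disagrees E (T (tl ws)) (CL (tl ws)) (tl (hd ws)) x"])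
  have M: "polyfun (Suc m) (\<lambda>vs. clocked (\<lambda>_ _. []) B [tl (hd vs)] (length (CL (tl vs))))"
    using polyfun_clocked_no_oracle[OF polyfun_weaken[OF CL], of "[\<lambda>vs. tl (hd vs)]" B]
    by (simp add: polyfun_tl polyfun_hd)
  have "polyfun (Suc m) (\<lambda>vs. if hd vs \<noteq> [] \<and>
      \<not> exists_string (disagrees E (T (tl vs)) (CL (tl vs)) (tl (hd vs))) (U (tl vs)) (T (tl vs))
      then True # tl (clocked (\<lambda>_ _. []) B [tl (hd vs)] (length (CL (tl vs)))) else [False])"
    by (intro polyfun_if polypred_conj polypred_not X M polypred_nonempty polyfun_hd polyfun_Cons
        polyfun_tl polyfun_Nil)
  from polyfun_let[OF R this] show ?thesis
    by (simp only: minimize_def Let_def list.sel)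
qed

text \<open>By properness the check is reliable whenever \<open>A\<close> halts. For a target in the
  class exactness makes it succeed; for any other target a successful check would itself exhibit a
  model computing \<open>f\<close>.\<close>

lemma minimize_correct:
  fixes f :: "bits \<Rightarrow> bool"
  assumes E: "evaluator C E TE" "TE n < length c"
    and A: "exact_learner C A TA" "proper_learner C A" "TA n < length c"
    and B: "model_minimizer C B TB" "TB n < length c"
    and out: "out = minimize A E B (truth_table n f) (replicate n True) c"
  shows "if computable_in C n f then \<exists>m. out = True # m \<and> minimum_model C n f m else out = [False]"
proof -
  let ?t = "truth_table n f" and ?u = "replicate n True"
  let ?ora = "answer E ?t ?u c"
  let ?r = "clocked ?ora A [?u] (length c)"
  have ora: "oracle_for C n f ?ora"
    by (rule oracle_for_answer[OF E]) simp
  have proper: "h \<in> models C" "nvars C h = n" if "halts_with ?ora A [?u] t h" for t h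
    using A(2) ora that unfolding proper_learner_def by blast+
  have check: "exists_string (disagrees E ?t c h) ?u ?t \<longleftrightarrow> \<not> computes C h n f"
    if "halts_with ?ora A [?u] t h" for t h
    using proper[OF that] by (intro exists_disagrees_iff[OF E]) auto
  show ?thesis
  proof (cases "computable_in C n f")
    case True
    with A(1) ora obtain t h where h: "t \<le> TA n" "halts_with ?ora A [?u] t h" "computes C h n f"
      unfolding exact_learner_def by blast
    have r: "?r = True # h"
      by (rule clocked_halts[OF h(2) le_less_trans[OF h(1) A(3)]])
    obtain m where m: "computes_within B [h] (TB n) m" "minimum_model C n (func C h) m"
      using B(1) proper[OF h(2)] unfolding model_minimizer_def by metis
    then obtain t' where t': "t' \<le> TB n" "halts_with (\<lambda>_ _. []) B [h] t' m"
      unfolding computes_within_def by blast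
    have "clocked (\<lambda>_ _. []) B [h] (length c) = True # m"
      by (rule clocked_halts[OF t'(2) le_less_trans[OF t'(1) B(2)]])
    then have "out = True # m"
      using r check[OF h(2)] h(3) by (simp add: out minimize_def)
    \<comment> \<open>Minimality depends on the target only through inputs of length
      \<open>n\<close>, where \<open>h\<close> and \<open>f\<close> agree.\<close>
    moreover have "minimum_model C n f m"
      using m(2) h(3) unfolding minimum_model_def computes_def by auto
    ultimately show ?thesis
      using True by simp
  next
    case False
    have "out = [False]"
    proof (cases "?r = []")
      case True
      then show ?thesis
        by (simp add: out minimize_def)
    next
      case r: False
      then obtain t h where h: "halts_with ?ora A [?u] t h" "?r = True # h"
        by (rule clocked_nonempty) blast
      with False proper check show ?thesis
        by (auto simp: out minimize_def computable_in_def)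
    qed
    with False show ?thesis
      by simp
  qed
qed

section \<open>Translating the asymptotic bounds\<close>

text \<open>The clock must suffice for every \<open>n\<close>, so the asymptotic bound is made
  uniform: beyond the threshold \<open>2 powr g n\<close> is at most \<open>(2 ^ n) ^ k\<close>, and
  the finitely many earlier values are absorbed by their sum \<open>l\<close>.\<close>

lemma two_pow_O_n_bound:
  assumes "two_pow_O_n T"
  shows "\<exists>k. \<forall>n. T n < (2 ^ n + 2) ^ k"
proof -
  obtain g where g: "g \<in> O(\<lambda>n. real n)" "\<And>n. real (T n) \<le> 2 powr g n"
    using assms unfolding two_pow_O_n_def by blast
  then obtain c where "c > 0" "eventually (\<lambda>n. norm (g n) \<le> c * norm (real n)) at_top"
    by (elim landau_o.bigE) auto
  then obtain n0 where n0: "\<And>n. n \<ge> n0 \<Longrightarrow> \<bar>g n\<bar> \<le> c * real n"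
    by (auto simp: eventually_at_top_linorder)
  obtain k where k: "c \<le> real k"
    using real_arch_simple by blast
  define l where "l = (\<Sum>i<n0. T i)"
  \<comment> \<open>The summand 1 in the exponent gives the strict inequality that
    \<open>clocked\<close> needs. It is used with \<open>x = 2\<close> below the threshold and with
    \<open>x = 2 ^ n\<close> from it on.\<close>
  have pow: "x ^ j < (2 ^ n + 2) ^ (k + l + 1)" if "x \<le> 2 ^ n + 2" "j \<le> k + l" for x j n :: nat
  proof -
    have "x ^ j \<le> (2 ^ n + 2) ^ j"
      using that by (intro power_mono) auto
    also have "\<dots> < (2 ^ n + 2) ^ (k + l + 1)"
      using that by (intro power_strict_increasing) auto
    finally show ?thesis .
  qed
  have "T n < (2 ^ n + 2) ^ (k + l + 1)" for n
  proof (cases "n < n0")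
    case True
    then have "T n \<le> l"
      unfolding l_def by (intro member_le_sum) auto
    then have "T n \<le> 2 ^ l"
      using less_exp[of l] by linarith
    with pow[of 2 n l] show ?thesis
      by simp
  next
    case False
    have "g n \<le> c * real n"
      using n0[of n] False by auto
    also have "\<dots> \<le> real k * real n"
      using k by (intro mult_right_mono) auto
    finally have "2 powr g n \<le> 2 powr real (n * k)"
      by (simp add: mult.commute)
    also have "\<dots> = 2 ^ (n * k)"
      by (rule powr_realpow) simp
    also have "\<dots> = real ((2 ^ n) ^ k)"
      by (simp add: power_mult)
    finally have "T n \<le> (2 ^ n) ^ k"
      using g(2)[of n] by linarith
    with pow[of "2 ^ n" n k] show ?thesis
      by simp
  qed
  then show ?thesis
    by blast
qed

lemma polynomially_bounded_if_poly_bounded: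
  assumes "poly_bounded T"
  shows "polynomially_bounded T"
proof -
  obtain k where k: "\<And>n. T n \<le> (n + 2) ^ k"
    using assms by (rule poly_boundedE) blast
  have "(\<lambda>n. real (T n)) \<in> O(\<lambda>n. real n ^ k)"
  proof (rule landau_o.bigI[of "3 ^ k"])
    show "eventually (\<lambda>n. norm (real (T n)) \<le> 3 ^ k * norm (real n ^ k)) at_top"
      using eventually_ge_at_top[of 1]
    proof eventually_elim
      case (elim n)
      \<comment> \<open>The constant \<open>3 ^ k\<close> comes from
        \<open>n + 2 \<le> 3 * n\<close>, valid for \<open>n \<ge> 1\<close>.\<close>
      have "T n \<le> (3 * n) ^ k"
        using k[of n] power_mono[of "n + 2" "3 * n" k] elim by linarith
      then have "real (T n) \<le> real ((3 * n) ^ k)"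
        by (rule of_nat_mono)
      then show ?case
        by (simp add: power_mult_distrib)
    qed
  qed simp
  then show ?thesis
    unfolding polynomially_bounded_def by blast
qed

text \<open>A \<open>polyfun\<close> program never overwrites its arguments, whereas input and
  output of a whole computation share register 0. So the value is computed in register 1, the input
  is cleared, and the value is moved.\<close>

lemma polyfun_computes_within:
  assumes "polyfun 1 F"
  obtains D T where "poly_bounded T" "\<And>w. computes_within D [w] (T (length w)) (F [w])"
proof -
  from assms obtain l where l: "\<And>ws. length ws = 1 \<Longrightarrow> length (F ws) \<le> (total_length ws + 2) ^ l"
    by (rule polyfun_length) blast
  from assms obtain p k where p: "queries p = {}"
    "\<And>s. s 1 = [] \<Longrightarrow> (\<And>r. r \<ge> 2 \<Longrightarrow> s r = []) \<Longrightarrow>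
       runs p s ((total_length (map s [0]) + 2) ^ k) (s(1 := F (map s [0])))"
    by (rule polyfun_prog[of 1 F "[0]" 2 1]) auto
  let ?T = "\<lambda>n. (n + 2) ^ k + ((2 * n + 1) + (8 * (n + 2) ^ l + 2))"
  show ?thesis
  proof (rule that[of ?T])
    show "poly_bounded ?T"
      by (intro poly_bounded_intros)
    fix w :: bits
    let ?s = "initial [w]"
    have s: "?s 0 = w" "?s (Suc i) = []" for i
      by (simp_all add: initial_def)
    have 1: "runs p ?s ((length w + 2) ^ k) (?s(1 := F [w]))"
      by (rule runs_eq[OF p(2)]) (auto simp: initial_def)
    have 2: "runs (clear 0) (?s(1 := F [w])) (2 * length w + 1) (?s(1 := F [w], 0 := []))"
      by (rule runs_eq[OF runs_clear]) (auto simp: s)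
    have 3: "runs (move 1 0 2) (?s(1 := F [w], 0 := [])) (8 * (length w + 2) ^ l + 2) (?s(0 := F [w]))"
      by (rule runs_eq[OF runs_move]) (use l[of "[w]"] in \<open>auto simp: initial_def fun_eq_iff\<close>)
    obtain t where "t \<le> ?T (length w)"
      "exec (\<lambda>_ _. []) (Seq p (Seq (clear 0) (move 1 0 2))) ?s t (?s(0 := F [w]))"
      using runs_Seq[OF 1 runs_Seq[OF 2 3]] unfolding runs_def by blast
    then show "computes_within (Seq p (Seq (clear 0) (move 1 0 2))) [w] (?T (length w)) (F [w])"
      unfolding computes_within_def halts_with_def using p(1) by fastforce
  qed
qed

theorem mainTheorem1:
  fixes C :: model_class
  assumes evaluation: "\<exists>E T. two_pow_O_n T \<and> evaluator C E T"
    and learning: "\<exists>A T. two_pow_O_n T \<and> exact_learner C A T \<and> proper_learner C A"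
    and minimization: "\<exists>B T. two_pow_O_n T \<and> model_minimizer C B T"
  shows "\<exists>D T. polynomially_bounded T \<and> truth_table_minimizer C D T"
proof -
  obtain E TE kE where E: "evaluator C E TE" "\<And>n. TE n < (2 ^ n + 2) ^ kE"
    using evaluation two_pow_O_n_bound by metis
  obtain A TA kA where A: "exact_learner C A TA" "proper_learner C A" "\<And>n. TA n < (2 ^ n + 2) ^ kA"
    using learning two_pow_O_n_bound by metis
  obtain B TB kB where B: "model_minimizer C B TB" "\<And>n. TB n < (2 ^ n + 2) ^ kB"
    using minimization two_pow_O_n_bound by metis
  define k where "k = kE + kA + kB"
  \<comment> \<open>The two extra bits give length \<open>2 ^ n + 2\<close> for a truth table, so
    the clock has length \<open>(2 ^ n + 2) ^ k\<close>; as \<open>k\<close> is the sum of the three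
    exponents, it exceeds all three running times.\<close>
  define clock where "clock t = pow k (True # True # t)" for t
  define F where "F ws = minimize A E B (ws ! 0) (unary_log (ws ! 0)) (clock (ws ! 0))" for ws
  have "polyfun 1 F"
    unfolding F_def[abs_def] clock_def
    by (intro polyfun_minimize polyfun_unary_log polyfun_pow polyfun_Cons polyfun_nth) simp_all
  then obtain D T where D: "poly_bounded T" "\<And>w. computes_within D [w] (T (length w)) (F [w])"
    by (rule polyfun_computes_within) blast
  have "truth_table_minimizer C D T"
    unfolding truth_table_minimizer_def
  proof (intro allI exI conjI)
    fix n f
    show "computes_within D [truth_table n f] (T (2 ^ n)) (F [truth_table n f])"
      using D(2)[of "truth_table n f"] by simp
    have less: "x < length (clock (truth_table n f))" if "x < (2 ^ n + 2) ^ j" "j \<le> k" for x j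
    proof -
      have "(2 ^ n + 2 :: nat) ^ j \<le> (2 ^ n + 2) ^ k"
        using that(2) by (intro power_increasing) auto
      with that(1) have "x < (2 ^ n + 2) ^ k"
        by linarith
      then show ?thesis
        by (simp add: clock_def)
    qed
    have "TE n < length (clock (truth_table n f))" "TA n < length (clock (truth_table n f))"
      "TB n < length (clock (truth_table n f))"
      using less[OF E(2)] less[OF A(3)] less[OF B(2)] by (simp_all add: k_def)
    then show "if computable_in C n f then \<exists>c. F [truth_table n f] = True # c \<and> minimum_model C n f c
        else F [truth_table n f] = [False]"
      using minimize_correct[OF E(1) _ A(1,2) _ B(1)] by (simp add: F_def unary_log_truth_table)
  qed
  with polynomially_bounded_if_poly_bounded[OF D(1)] show ?thesis
    by blast
qed

end
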